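(* Let $T$ be a tree of order $n\ge 3$. Then $T$ is a $\gamma_{ri2}$-stable tree if and only if $T\in\mathcal{T}$.
   Context: All graphs are finite, without loops or multiple edges. A 2-rainbow independent dominating function (2RiDF) of a graph $G$ is a function $f:V(G)\to\{0,1,2\}$ such that, writing $V_i=\{x\in V(G): f(x)=i\}$, the sets $V_1$ and $V_2$ are each independent and every vertex $u$ with $f(u)=0$ is adjacent to at least one vertex of $V_1$ and at least one vertex of $V_2$. Its weight is $w(f)=|V_1|+|V_2|$. The 2-rainbow independent domination number $\gamma_{ri2}(G)$ is the minimum weight of a 2RiDF of $G$; a $\gamma_{ri2}$-function on $G$ is a 2RiDF of $G$ of weight $\gamma_{ri2}(G)$. A graph $G$ is $\gamma_{ri2}$-stable if $\gamma_{ri2}(G-v)=\gamma_{ri2}(G)$ for every vertex $v$ of $G$. For a graph $G$, $W_0(G)=\{v\in V(G): f(v)=0 \text{ for every } \gamma_{ri2}\text{-function } f \text{ on } G\}$. $P_n$ is the path on $n$ vertices. For $k\ge 2$, the spider $S_k^{v_1}$ is the tree obtained from $k$ vertex-disjoint paths $v_1^iv_2^iv_3^i$ ($1\le i\le k$) by adding a new vertex $v_1$ (the head) and joining it to $v_1^1,v_1^2,\ldots,v_1^k$. $\mathcal{T}$ is the family of all trees $T$ for which there is a sequence of trees $T_1,T_2,\ldots,T_r$ ($r\ge 1$) such that $T_1\in\{P_3\}\cup\{S_k^{v_1}: k\ge 3\}$, $T=T_r$, and, if $r\ge 2$, each $T_{i+1}$ is obtained from $T_i$ by one of the following operations: Operation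 $\mathcal{O}_1$: for some $x\in W_0(T_i)$, add a new path $v_2v_1v_3$ and join $x$ to $v_1$. Operation $\mathcal{O}_2$: for some $x\in V(T_i)\setminus W_0(T_i)$, add a new path $v_4v_3v_2v_1v_5v_6v_7$ and join $x$ to $v_1$. Operation $\mathcal{O}_3$: for some $x\in V(T_i)$, add a new spider $S_k^{v_1}$ with $k\ge 3$ and join $x$ to its head $v_1$. *)

theory Defs
  imports "Graph_Theory.Graph_Theory"
begin

section \<open>Trees\<close>

text \<open>
  A finite simple undirected graph is a \<^locale>\<open>pair_graph\<close>: a finite loop-free digraph with
  pairs as arcs whose arc relation is symmetric. The constant \<^const>\<open>tree\<close> of the library is not
  usable here, since in a symmetric digraph every edge already yields the directed cycle
  \<open>u, v, u\<close> of length 2. A cycle of the undirected graph is a directed cycle of length at least 3.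
\<close>

definition is_tree :: "'a pair_pre_digraph \<Rightarrow> bool" where
  "is_tree G \<longleftrightarrow> pair_graph G \<and> connected (with_proj G) \<and>
     \<not> (\<exists>p. pre_digraph.cycle (with_proj G) p \<and> 3 \<le> length p)"


section \<open>2-rainbow independent domination\<close>

text \<open>
  These notions are stated for \<^typ>\<open>('a, 'b) pre_digraph\<close>, so that they apply to
  \<^const>\<open>pre_digraph.del_vert\<close>. Values of \<open>f\<close> outside \<^term>\<open>verts G\<close> are irrelevant.
\<close>

definition color_class :: "('a, 'b) pre_digraph \<Rightarrow> ('a \<Rightarrow> nat) \<Rightarrow> nat \<Rightarrow> 'a set" where
  "color_class G f i = {x \<in> verts G. f x = i}"

definition independent :: "('a, 'b) pre_digraph \<Rightarrow> 'a set \<Rightarrow> bool" where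
  "independent G S \<longleftrightarrow> S \<subseteq> verts G \<and> (\<forall>u\<in>S. \<forall>v\<in>S. \<not> u \<rightarrow>\<^bsub>G\<^esub> v)"

definition is_2RiDF :: "('a, 'b) pre_digraph \<Rightarrow> ('a \<Rightarrow> nat) \<Rightarrow> bool" where
  "is_2RiDF G f \<longleftrightarrow>
     (\<forall>x\<in>verts G. f x \<in> {0, 1, 2}) \<and>
     independent G (color_class G f 1) \<and> independent G (color_class G f 2) \<and>
     (\<forall>u\<in>verts G. f u = 0 \<longrightarrow>
        (\<exists>v\<in>color_class G f 1. u \<rightarrow>\<^bsub>G\<^esub> v) \<and> (\<exists>v\<in>color_class G f 2. u \<rightarrow>\<^bsub>G\<^esub> v))"

definition weight :: "('a, 'b) pre_digraph \<Rightarrow> ('a \<Rightarrow> nat) \<Rightarrow> nat" where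
  "weight G f = card (color_class G f 1) + card (color_class G f 2)"

definition gamma_ri2 :: "('a, 'b) pre_digraph \<Rightarrow> nat" where
  "gamma_ri2 G = (LEAST w. \<exists>f. is_2RiDF G f \<and> weight G f = w)"

definition is_gamma_ri2_function :: "('a, 'b) pre_digraph \<Rightarrow> ('a \<Rightarrow> nat) \<Rightarrow> bool" where
  "is_gamma_ri2_function G f \<longleftrightarrow> is_2RiDF G f \<and> weight G f = gamma_ri2 G"

definition gamma_ri2_stable :: "('a, 'b) pre_digraph \<Rightarrow> bool" where
  "gamma_ri2_stable G \<longleftrightarrow>
     (\<forall>v\<in>verts G. gamma_ri2 (pre_digraph.del_vert G v) = gamma_ri2 G)"

definition W0 :: "('a, 'b) pre_digraph \<Rightarrow> 'a set" where
  "W0 G = {v \<in> verts G. \<forall>f. is_gamma_ri2_function G f \<longrightarrow> f v = 0}"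


section \<open>The family of trees\<close>

definition undirected :: "'a set \<Rightarrow> ('a \<times> 'a) set \<Rightarrow> 'a pair_pre_digraph" where
  "undirected V E = \<lparr>pverts = V, parcs = E \<union> E\<inverse>\<rparr>"

definition path_graph :: "'a list \<Rightarrow> 'a pair_pre_digraph" where
  "path_graph xs = undirected (set xs) (set (zip xs (tl xs)))"

definition spider_graph :: "nat \<Rightarrow> 'a \<Rightarrow> (nat \<Rightarrow> nat \<Rightarrow> 'a) \<Rightarrow> 'a pair_pre_digraph" where
  "spider_graph k h p = undirected
     (insert h {p i j | i j. i \<in> {1..k} \<and> j \<in> {1..3}})
     (\<Union>i\<in>{1..k}. {(h, p i 1), (p i 1, p i 2), (p i 2, p i 3)})"

definition is_P3 :: "'a pair_pre_digraph \<Rightarrow> bool" where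
  "is_P3 G \<longleftrightarrow> (\<exists>xs. length xs = 3 \<and> distinct xs \<and> G = path_graph xs)"

definition is_spider :: "nat \<Rightarrow> 'a \<Rightarrow> 'a pair_pre_digraph \<Rightarrow> bool" where
  "is_spider k h G \<longleftrightarrow> 2 \<le> k \<and>
     (\<exists>p. inj_on (\<lambda>(i, j). p i j) ({1..k} \<times> {1..3}) \<and>
          (\<forall>i\<in>{1..k}. \<forall>j\<in>{1..3}. p i j \<noteq> h) \<and>
          G = spider_graph k h p)"

definition attach ::
    "'a pair_pre_digraph \<Rightarrow> 'a \<Rightarrow> 'a pair_pre_digraph \<Rightarrow> 'a \<Rightarrow> 'a pair_pre_digraph" where
  "attach G x H y =
     \<lparr>pverts = pverts G \<union> pverts H, parcs = parcs G \<union> parcs H \<union> {(x, y), (y, x)}\<rparr>"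

definition op1 :: "'a pair_pre_digraph \<Rightarrow> 'a pair_pre_digraph \<Rightarrow> bool" where
  "op1 T T' \<longleftrightarrow> (\<exists>x v1 v2 v3.
     x \<in> W0 (with_proj T) \<and>
     distinct [v2, v1, v3] \<and> pverts T \<inter> {v2, v1, v3} = {} \<and>
     T' = attach T x (path_graph [v2, v1, v3]) v1)"

definition op2 :: "'a pair_pre_digraph \<Rightarrow> 'a pair_pre_digraph \<Rightarrow> bool" where
  "op2 T T' \<longleftrightarrow> (\<exists>x v1 v2 v3 v4 v5 v6 v7.
     x \<in> pverts T - W0 (with_proj T) \<and>
     distinct [v4, v3, v2, v1, v5, v6, v7] \<and> pverts T \<inter> {v4, v3, v2, v1, v5, v6, v7} = {} \<and>
     T' = attach T x (path_graph [v4, v3, v2, v1, v5, v6, v7]) v1)"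

definition op3 :: "'a pair_pre_digraph \<Rightarrow> 'a pair_pre_digraph \<Rightarrow> bool" where
  "op3 T T' \<longleftrightarrow> (\<exists>x k v1 S.
     x \<in> pverts T \<and> 3 \<le> k \<and> is_spider k v1 S \<and> pverts T \<inter> pverts S = {} \<and>
     T' = attach T x S v1)"

text \<open>
  The graphs in the sequence all live on the vertex type of \<open>T\<close>. Since \<open>T\<^sub>1\<close> may use any vertices of
  that type, the family is closed under isomorphism, and every intermediate tree is realised as
  a subgraph of the last one; no generality is lost even on a finite vertex type.
\<close>

definition tree_family :: "'a pair_pre_digraph set" where
  "tree_family = {T. \<exists>Ts. Ts \<noteq> [] \<and> (\<forall>S\<in>set Ts. is_tree S) \<and>
     (is_P3 (hd Ts) \<or> (\<exists>k h. 3 \<le> k \<and> is_spider k h (hd Ts))) \<and>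
     (\<forall>i. Suc i < length Ts \<longrightarrow>
        op1 (Ts ! i) (Ts ! Suc i) \<or> op2 (Ts ! i) (Ts ! Suc i) \<or> op3 (Ts ! i) (Ts ! Suc i)) \<and>
     last Ts = T}"

end

theory Submission
  imports Defs
begin

text \<open>
  In a forest the two colours play no role: a set \<open>S\<close> can be 2-coloured so that every vertex outside
  \<open>S\<close> with two neighbours in \<open>S\<close> sees both colours, hence the 2-rainbow independent domination number
  is the 2-domination number, and \<open>W\<^sub>0\<close> consists of the vertices in no minimum 2-dominating set.

  Attaching a \<open>P\<^sub>3\<close> by its centre or a spider by its head raises the 2-domination number by a constant
  \<open>c\<close>, also after deleting vertices of the old tree. Hence the new tree is stable iff the old one is and
  deleting a vertex of the new piece still leaves the value \<open>\<gamma> + c\<close>; the latter is exactly the side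
  condition of the operation. It remains to find such a piece in every stable tree. There a
  neighbour of a leaf lies in no minimum set, and neither does the head of a pendant path on three
  vertices; with a vertex deletion argument these facts determine the tree close to its deepest leaves.
\<close>

section \<open>2-domination\<close>

text \<open>The obstacle in attaching a piece is that its head \<open>y\<close> may help to dominate
  the attaching vertex \<open>x\<close>. The increase is nevertheless a constant (2 for the short
  path, 2k for a spider with k legs): a set that uses \<open>y\<close> has one vertex more than
  necessary inside the piece, and this surplus pays for choosing \<open>x\<close> instead. After a
  deletion inside the piece the surplus can vanish. Then stability of the old tree takes over, since
  leaving \<open>x\<close> undominated saves nothing there.

  The seven-vertex path of the second operation is a spider with two legs, so the last two
  operations are one construction. The threshold three comes from the head: if the first vertex of a
  leg is deleted, a head outside the set still needs two chosen neighbours. From three legs on the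
  other legs supply both; with two legs one of them has to be \<open>x\<close>.\<close>

definition dom2 :: "('a \<Rightarrow> 'a \<Rightarrow> bool) \<Rightarrow> 'a set \<Rightarrow> 'a set \<Rightarrow> bool" where
  "dom2 E S D \<longleftrightarrow> (\<forall>u\<in>D - S. \<exists>a\<in>S. \<exists>b\<in>S. a \<noteq> b \<and> E u a \<and> E u b)"

definition gam2 :: "('a \<Rightarrow> 'a \<Rightarrow> bool) \<Rightarrow> 'a set \<Rightarrow> nat" where
  "gam2 E V = (LEAST n. \<exists>S\<subseteq>V. dom2 E S V \<and> card S = n)"

definition minset :: "('a \<Rightarrow> 'a \<Rightarrow> bool) \<Rightarrow> 'a set \<Rightarrow> 'a set \<Rightarrow> bool" where
  "minset E V S \<longleftrightarrow> S \<subseteq> V \<and> dom2 E S V \<and> card S = gam2 E V"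

definition stable2 :: "('a \<Rightarrow> 'a \<Rightarrow> bool) \<Rightarrow> 'a set \<Rightarrow> bool" where
  "stable2 E V \<longleftrightarrow> (\<forall>v\<in>V. gam2 E (V - {v}) = gam2 E V)"

text \<open>For symmetric loop-free \<open>E\<close> these are the 1-degenerate graphs, that is, the
  forests. The form passes to subsets at once and yields a vertex to remove in an induction without
  mentioning cycles.\<close>

definition acyclic_on :: "('a \<Rightarrow> 'a \<Rightarrow> bool) \<Rightarrow> 'a set \<Rightarrow> bool" where
  "acyclic_on E V \<longleftrightarrow>
     (\<forall>U\<subseteq>V. U \<noteq> {} \<longrightarrow> (\<exists>u\<in>U. \<forall>a\<in>U. \<forall>b\<in>U. E u a \<longrightarrow> E u b \<longrightarrow> a = b))"

lemma gam2_le: "S \<subseteq> V \<Longrightarrow> dom2 E S V \<Longrightarrow> gam2 E V \<le> card S"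
  unfolding gam2_def by (rule Least_le) blast

lemma minset_exists: "\<exists>S. minset E V S"
proof -
  have "\<exists>n. \<exists>S\<subseteq>V. dom2 E S V \<and> card S = n"
    by (intro exI[of _ "card V"] exI[of _ V]) (simp add: dom2_def)
  from LeastI_ex[OF this] show ?thesis
    unfolding minset_def gam2_def by blast
qed

lemma minsetD: "minset E V S \<Longrightarrow> S \<subseteq> V" "minset E V S \<Longrightarrow> dom2 E S V"
  "minset E V S \<Longrightarrow> card S = gam2 E V"
  by (auto simp: minset_def)

lemma dom2E:
  assumes "dom2 E S D" "u \<in> D" "u \<notin> S"
  obtains a b where "a \<in> S" "b \<in> S" "a \<noteq> b" "E u a" "E u b"
  using assms unfolding dom2_def by blast

lemma dom2_cong:
  assumes "\<And>u v. u \<in> V \<Longrightarrow> v \<in> V \<Longrightarrow> E u v \<longleftrightarrow> E' u v" "S \<subseteq> V" "D \<subseteq> V"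
  shows "dom2 E S D \<longleftrightarrow> dom2 E' S D"
proof -
  have "E u a \<longleftrightarrow> E' u a" if "u \<in> D" "a \<in> S" for u a
    using assms that by blast
  then show ?thesis unfolding dom2_def by (metis DiffD1)
qed

lemma gam2_cong:
  assumes "\<And>u v. u \<in> V \<Longrightarrow> v \<in> V \<Longrightarrow> E u v \<longleftrightarrow> E' u v"
  shows "gam2 E V = gam2 E' V"
proof -
  have "dom2 E S V \<longleftrightarrow> dom2 E' S V" if "S \<subseteq> V" for S
    using dom2_cong[of V E E' S V] assms that by blast
  then have "(\<exists>S\<subseteq>V. dom2 E S V \<and> card S = n) \<longleftrightarrow> (\<exists>S\<subseteq>V. dom2 E' S V \<and> card S = n)" for n
    by blast
  then show ?thesis unfolding gam2_def by simp
qed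

lemma dom2_Un: "dom2 E S D \<Longrightarrow> dom2 E Q D' \<Longrightarrow> dom2 E (S \<union> Q) (D \<union> D')"
  unfolding dom2_def by blast

lemma stable2_gam2_le:
  assumes "stable2 E V" "p \<in> V" "S \<subseteq> V - {p}" "dom2 E S (V - {p})"
  shows "gam2 E V \<le> card S"
  using gam2_le[OF assms(3,4)] assms(1,2) by (simp add: stable2_def)

text \<open>Exempting one vertex gains nothing in a stable graph: if \<open>x\<close> is a vertex
  outside \<open>S\<close>, then \<open>S\<close> lives in \<open>V - {x}\<close>, where the value
  is the same; otherwise nothing was exempted. This covers an \<open>x\<close> that is dominated
  with help from an attached piece.\<close>

lemma stable2_gam2_le':
  assumes "finite V" "stable2 E V" "S \<subseteq> V" "dom2 E S (V - {x})"
  shows "gam2 E V \<le> card S"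
proof (cases "x \<in> V - S")
  case True
  with assms stable2_gam2_le[of E V x S] show ?thesis by blast
next
  case False
  then have "V - {x} - S = V - S" using assms(3) by auto
  then have "dom2 E S V" using assms(4) unfolding dom2_def by metis
  then show ?thesis using gam2_le assms(3) by blast
qed

lemma stable2_minset_del:
  assumes "stable2 E V" "p \<in> V"
  obtains S where "S \<subseteq> V - {p}" "dom2 E S (V - {p})" "card S = gam2 E V"
  using minset_exists[of E "V - {p}"] assms unfolding minset_def stable2_def by metis

lemma acyclic_on_subset: "acyclic_on E V \<Longrightarrow> U \<subseteq> V \<Longrightarrow> acyclic_on E U"
  unfolding acyclic_on_def by (auto dest: subset_trans)


section \<open>Forests: rainbow domination is 2-domination\<close>

text \<open>A vertex with fewer than two neighbours in \<open>S\<close> imposes nothing. Without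
  this weakening the induction would fail, since removing a vertex may leave others with too few
  chosen neighbours.\<close>

definition rainbow :: "('a \<Rightarrow> 'a \<Rightarrow> bool) \<Rightarrow> 'a set \<Rightarrow> 'a set \<Rightarrow> ('a \<Rightarrow> nat) \<Rightarrow> bool" where
  "rainbow E V S f \<longleftrightarrow> (\<forall>u\<in>S. f u \<in> {1, 2}) \<and> (\<forall>u\<in>S. \<forall>v\<in>S. E u v \<longrightarrow> f u \<noteq> f v) \<and>
    (\<forall>u\<in>V - S. (\<exists>a\<in>S. \<exists>b\<in>S. a \<noteq> b \<and> E u a \<and> E u b) \<longrightarrow>
        (\<exists>a\<in>S. E u a \<and> f a = 1) \<and> (\<exists>b\<in>S. E u b \<and> f b = 2))"

lemma rainbowD:
  assumes "rainbow E V S f"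
  shows "\<And>u. u \<in> S \<Longrightarrow> f u \<in> {1, 2}"
    and "\<And>u v. u \<in> S \<Longrightarrow> v \<in> S \<Longrightarrow> E u v \<Longrightarrow> f u \<noteq> f v"
    and "\<And>u. u \<in> V - S \<Longrightarrow> (\<exists>a\<in>S. \<exists>b\<in>S. a \<noteq> b \<and> E u a \<and> E u b) \<Longrightarrow>
        (\<exists>a\<in>S. E u a \<and> f a = 1) \<and> (\<exists>b\<in>S. E u b \<and> f b = 2)"
  using assms unfolding rainbow_def by blast+

lemma acyclic_colouring:
  assumes "finite V" "acyclic_on E V" "S \<subseteq> V"
    and sym: "symp E" and irr: "irreflp E"
  shows "\<exists>f. rainbow E V S f"
  using assms(1-3)
proof (induction "card V" arbitrary: V S rule: less_induct)
  case less
  show ?case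
  proof (cases "V = {}")
    case True
    then show ?thesis using less.prems by (auto simp: rainbow_def)
  next
    case False
    with less.prems(2) obtain u where u: "u \<in> V" "\<And>a b. a \<in> V \<Longrightarrow> b \<in> V \<Longrightarrow> E u a \<Longrightarrow> E u b \<Longrightarrow> a = b"
      unfolding acyclic_on_def by (metis order_refl)
    let ?V = "V - {u}" and ?S = "S - {u}"
    have "card ?V < card V" using u less.prems(1) by (meson card_Diff1_less)
    moreover have "acyclic_on E ?V" using less.prems(2) acyclic_on_subset by blast
    ultimately obtain f where "rainbow E ?V ?S f"
      using less.hyps[of ?V ?S] less.prems(1,3) by auto
    note f = rainbowD[OF this]
    \<comment> \<open>A colour is bad for \<open>u\<close> if it clashes with the only neighbour
      \<open>w\<close>, or if it would leave a \<open>w\<close> outside \<open>S\<close> with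
      neighbours of this one colour only.\<close>
    define bad where "bad c \<longleftrightarrow> (\<exists>w\<in>V. E u w \<and>
        (w \<in> S \<and> f w = c \<or> w \<notin> S \<and> (\<exists>a\<in>?S. E w a) \<and> (\<forall>a\<in>?S. E w a \<longrightarrow> f a = c)))" for c
    \<comment> \<open>Both colours would be excluded by the same \<open>w\<close>. The existence of
      a neighbour of \<open>w\<close> in \<open>?S\<close> is part of \<open>bad\<close> so that its
      neighbours cannot all have colour 1 and all have colour 2.\<close>
    have "\<not> (bad 1 \<and> bad 2)"
    proof
      assume "bad 1 \<and> bad 2"
      then obtain w w' where w: "w \<in> V" "E u w" "w' \<in> V" "E u w'"
        "w \<in> S \<and> f w = 1 \<or> w \<notin> S \<and> (\<exists>a\<in>?S. E w a) \<and> (\<forall>a\<in>?S. E w a \<longrightarrow> f a = 1)"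
        "w' \<in> S \<and> f w' = 2 \<or> w' \<notin> S \<and> (\<exists>a\<in>?S. E w' a) \<and> (\<forall>a\<in>?S. E w' a \<longrightarrow> f a = 2)"
        unfolding bad_def by blast
      moreover have "w' = w" using w u(2) by blast
      ultimately show False by fastforce
    qed
    then obtain c where c: "c \<in> {1, 2}" "\<not> bad c" by blast
    define g where "g = f(u := c)"
    have g: "g v = f v" if "v \<noteq> u" for v using that by (simp add: g_def)
    have gu: "g u = c" by (simp add: g_def)
    have "g v \<in> {1, 2}" if "v \<in> S" for v
      using that f(1) c(1) by (cases "v = u") (auto simp: g_def)
    moreover have "g v \<noteq> g w" if vw: "v \<in> S" "w \<in> S" "E v w" for v w
    proof -
      have *: "f w \<noteq> c" if "w \<in> S" "E u w" for w
        using c(2) less.prems(3) that unfolding bad_def by blast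
      consider "v = u" "w \<noteq> u" | "w = u" "v \<noteq> u" | "v \<noteq> u" "w \<noteq> u"
        using irreflpD[OF irr] vw by blast
      then show ?thesis
      proof cases
        case 1
        then show ?thesis using vw *[of w] g[of w] gu by auto
      next
        case 2
        then show ?thesis using vw *[of v] sympD[OF sym vw(3)] g[of v] gu by auto
      next
        case 3
        then show ?thesis using vw f(2)[of v w] g[of v] g[of w] by auto
      qed
    qed
    moreover have "(\<exists>a\<in>S. E v a \<and> g a = 1) \<and> (\<exists>b\<in>S. E v b \<and> g b = 2)"
      if v: "v \<in> V - S" and ab: "a \<in> S" "b \<in> S" "a \<noteq> b" "E v a" "E v b" for v a b
    proof -
      have "v \<noteq> u" using u(2) ab less.prems(3) by blast
      show ?thesis
      proof (cases "\<exists>a\<in>?S. \<exists>b\<in>?S. a \<noteq> b \<and> E v a \<and> E v b")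
        case True
        then have "(\<exists>a\<in>?S. E v a \<and> f a = 1) \<and> (\<exists>b\<in>?S. E v b \<and> f b = 2)"
          using f(3) v \<open>v \<noteq> u\<close> by blast
        then show ?thesis using g by fastforce
      next
        case False
        \<comment> \<open>Here \<open>u\<close> is one of exactly two chosen neighbours of
          \<open>v\<close>, so \<open>v\<close> is the vertex \<open>w\<close> that
          \<open>bad\<close> speaks about.\<close>
        then obtain d where d: "d \<in> ?S" "E v d" "u \<in> S" "E v u"
          using ab by blast
        have "f d \<noteq> c"
        proof
          assume "f d = c"
          moreover have "a = d" if "a \<in> ?S" "E v a" for a using False d(1,2) that by blast
          ultimately have "\<forall>a\<in>?S. E v a \<longrightarrow> f a = c" by blast
          moreover have "v \<in> V" "v \<notin> S" using v by auto
          ultimately have "bad c"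
            unfolding bad_def using d(1,2) sympD[OF sym d(4)] by (intro bexI[of _ v]) auto
          then show False using c(2) by blast
        qed
        moreover have "f d \<in> {1, 2}" using f(1) d by blast
        ultimately show ?thesis using d c(1) g[of d] gu by auto
      qed
    qed
    ultimately show ?thesis unfolding rainbow_def by (intro exI[of _ g]) blast
  qed
qed

text \<open>\<open>E\<close> has to agree with adjacency on \<open>verts H\<close> only, so one
  relation serves a tree together with all its vertex-deleted subgraphs. The support of a rainbow
  function is 2-dominating, and \<open>acyclic_colouring\<close> turns a 2-dominating set back into
  a support.\<close>

lemma gamma_ri2_eq_gam2:
  assumes fin: "finite (verts H)" and ac: "acyclic_on E (verts H)"
    and sym: "symp E" and irr: "irreflp E"
    and adj: "\<And>u v. u \<in> verts H \<Longrightarrow> v \<in> verts H \<Longrightarrow> (u \<rightarrow>\<^bsub>H\<^esub> v) \<longleftrightarrow> E u v"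
  shows is_2RiDF_support: "\<And>f. is_2RiDF H f \<Longrightarrow> dom2 E {x \<in> verts H. f x \<noteq> 0} (verts H)"
    and weight_support: "\<And>f. is_2RiDF H f \<Longrightarrow> weight H f = card {x \<in> verts H. f x \<noteq> 0}"
    and ex_2RiDF: "\<And>S. S \<subseteq> verts H \<Longrightarrow> dom2 E S (verts H) \<Longrightarrow>
      \<exists>f. is_2RiDF H f \<and> {x \<in> verts H. f x \<noteq> 0} = S"
    and "gamma_ri2 H = gam2 E (verts H)"
proof -
  show 1: "dom2 E {x \<in> verts H. f x \<noteq> 0} (verts H)" if f: "is_2RiDF H f" for f
    unfolding dom2_def
  proof
    fix u assume u: "u \<in> verts H - {x \<in> verts H. f x \<noteq> 0}"
    then obtain a b where "a \<in> color_class H f 1" "u \<rightarrow>\<^bsub>H\<^esub> a" "b \<in> color_class H f 2" "u \<rightarrow>\<^bsub>H\<^esub> b"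
      using f unfolding is_2RiDF_def by blast
    then show "\<exists>a\<in>{x \<in> verts H. f x \<noteq> 0}. \<exists>b\<in>{x \<in> verts H. f x \<noteq> 0}. a \<noteq> b \<and> E u a \<and> E u b"
      using adj u unfolding color_class_def by (intro bexI[of _ a] bexI[of _ b]) auto
  qed
  show 2: "weight H f = card {x \<in> verts H. f x \<noteq> 0}" if f: "is_2RiDF H f" for f
  proof -
    have "{x \<in> verts H. f x \<noteq> 0} = color_class H f 1 \<union> color_class H f 2"
      using f unfolding is_2RiDF_def color_class_def by auto
    moreover have "card (color_class H f 1 \<union> color_class H f 2) = weight H f"
      unfolding weight_def using fin by (intro card_Un_disjoint) (auto simp: color_class_def)
    ultimately show ?thesis by simp
  qed
  show 3: "\<exists>f. is_2RiDF H f \<and> {x \<in> verts H. f x \<noteq> 0} = S"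
    if S: "S \<subseteq> verts H" and d: "dom2 E S (verts H)" for S
  proof -
    obtain f where "rainbow E (verts H) S f"
      using acyclic_colouring[OF fin ac S sym irr] by blast
    note f = rainbowD[OF this]
    define g where "g v = (if v \<in> S then f v else 0)" for v
    have "f u \<noteq> 0" if "u \<in> S" for u using f(1)[OF that] by auto
    then have supp: "{x \<in> verts H. g x \<noteq> 0} = S"
      using S by (auto simp: g_def)
    have cc: "color_class H g i = {x \<in> S. f x = i}" if "i \<noteq> 0" for i
      using S that by (auto simp: color_class_def g_def)
    have "independent H (color_class H g i)" if "i \<noteq> 0" for i
      unfolding independent_def cc[OF that] using S f(2) adj by blast
    moreover have "\<forall>x\<in>verts H. g x \<in> {0, 1, 2}" using f(1) by (auto simp: g_def)
    moreover have "(\<exists>v\<in>color_class H g 1. u \<rightarrow>\<^bsub>H\<^esub> v) \<and> (\<exists>v\<in>color_class H g 2. u \<rightarrow>\<^bsub>H\<^esub> v)"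
      if u: "u \<in> verts H" "g u = 0" for u
    proof -
      have "u \<notin> S" using u supp by blast
      then have "(\<exists>a\<in>S. E u a \<and> f a = 1) \<and> (\<exists>b\<in>S. E u b \<and> f b = 2)"
        using f(3)[of u] u d unfolding dom2_def by blast
      then show ?thesis using adj u S by (auto simp: cc)
    qed
    ultimately have "is_2RiDF H g" unfolding is_2RiDF_def by simp
    then show ?thesis using supp by blast
  qed
  have "(\<exists>f. is_2RiDF H f \<and> weight H f = n) \<longleftrightarrow> (\<exists>S\<subseteq>verts H. dom2 E S (verts H) \<and> card S = n)" for n
  proof
    assume "\<exists>f. is_2RiDF H f \<and> weight H f = n"
    then obtain f where "is_2RiDF H f" "weight H f = n" by blast
    then show "\<exists>S\<subseteq>verts H. dom2 E S (verts H) \<and> card S = n"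
      using 1 2 by (intro exI[of _ "{x \<in> verts H. f x \<noteq> 0}"]) auto
  next
    assume "\<exists>S\<subseteq>verts H. dom2 E S (verts H) \<and> card S = n"
    then obtain S where S: "S \<subseteq> verts H" "dom2 E S (verts H)" "card S = n" by blast
    then obtain f where f: "is_2RiDF H f" "{x \<in> verts H. f x \<noteq> 0} = S" using 3 by blast
    then have "weight H f = n" using 2[OF f(1)] S(3) by simp
    then show "\<exists>f. is_2RiDF H f \<and> weight H f = n" using f(1) by blast
  qed
  then show "gamma_ri2 H = gam2 E (verts H)"
    unfolding gamma_ri2_def gam2_def by simp
qed

lemma W0_eq_minset:
  assumes "finite (verts H)" "acyclic_on E (verts H)"
    and sym: "symp E" and irr: "irreflp E"
    and adj: "\<And>u v. u \<in> verts H \<Longrightarrow> v \<in> verts H \<Longrightarrow> (u \<rightarrow>\<^bsub>H\<^esub> v) \<longleftrightarrow> E u v"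
  shows "W0 H = {v \<in> verts H. \<forall>S. minset E (verts H) S \<longrightarrow> v \<notin> S}"
proof -
  note facts = gamma_ri2_eq_gam2[OF assms]
  have "(\<forall>f. is_gamma_ri2_function H f \<longrightarrow> f v = 0) \<longleftrightarrow> (\<forall>S. minset E (verts H) S \<longrightarrow> v \<notin> S)"
    if v: "v \<in> verts H" for v
  proof (intro iffI allI impI)
    fix S assume *: "\<forall>f. is_gamma_ri2_function H f \<longrightarrow> f v = 0" and S: "minset E (verts H) S"
    then obtain f where "is_2RiDF H f" "{x \<in> verts H. f x \<noteq> 0} = S"
      using facts(3) unfolding minset_def by blast
    moreover from this have "f v = 0"
      using * S facts(2,4) unfolding is_gamma_ri2_function_def minset_def by simp
    ultimately show "v \<notin> S" by blast
  next
    fix f assume *: "\<forall>S. minset E (verts H) S \<longrightarrow> v \<notin> S" and f: "is_gamma_ri2_function H f"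
    then have "minset E (verts H) {x \<in> verts H. f x \<noteq> 0}"
      using facts(1,2,4) unfolding is_gamma_ri2_function_def minset_def by auto
    then show "f v = 0" using * v by blast
  qed
  then show ?thesis unfolding W0_def by blast
qed

section \<open>Attaching a pendant piece\<close>

text \<open>No edge except \<open>x y\<close> crosses between the two sides, so every vertex other
  than its ends finds both its witnesses on its own side. The vertex \<open>x\<close> can profit
  from the other side only through a chosen \<open>y\<close>.\<close>

lemma dom2_restrict:
  assumes d: "dom2 E S (U \<union> P)" and S: "S \<subseteq> U \<union> P" and disj: "U \<inter> P = {}"
    and cut: "\<forall>u\<in>U. \<forall>p\<in>P. E u p \<longrightarrow> u = x \<and> p = y"
    and sym: "symp E"
  shows "dom2 E (S \<inter> U) (U - {x})" and "dom2 E (S \<inter> P) (P - {y})"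
    and "y \<notin> S \<Longrightarrow> dom2 E (S \<inter> U) U"
proof -
  have R: "a \<in> S \<inter> U" if "u \<in> U" "a \<in> S" "E u a" "u \<noteq> x \<or> y \<notin> S" for u a
    using cut that S by blast
  have P: "a \<in> S \<inter> P" if "u \<in> P" "a \<in> S" "E u a" "u \<noteq> y" for u a
    using cut sympD[OF sym \<open>E u a\<close>] that S by blast
  show "dom2 E (S \<inter> U) (U - {x})"
    unfolding dom2_def
  proof
    fix u assume u: "u \<in> U - {x} - S \<inter> U"
    then obtain a b where "a \<in> S" "b \<in> S" "a \<noteq> b" "E u a" "E u b"
      using dom2E[OF d, of u] by blast
    then show "\<exists>a\<in>S \<inter> U. \<exists>b\<in>S \<inter> U. a \<noteq> b \<and> E u a \<and> E u b" using u R by blast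
  qed
  show "dom2 E (S \<inter> P) (P - {y})"
    unfolding dom2_def
  proof
    fix u assume u: "u \<in> P - {y} - S \<inter> P"
    then obtain a b where "a \<in> S" "b \<in> S" "a \<noteq> b" "E u a" "E u b"
      using dom2E[OF d, of u] by blast
    then show "\<exists>a\<in>S \<inter> P. \<exists>b\<in>S \<inter> P. a \<noteq> b \<and> E u a \<and> E u b" using u P by blast
  qed
  assume "y \<notin> S"
  show "dom2 E (S \<inter> U) U"
    unfolding dom2_def
  proof
    fix u assume u: "u \<in> U - S \<inter> U"
    then obtain a b where "a \<in> S" "b \<in> S" "a \<noteq> b" "E u a" "E u b"
      using dom2E[OF d, of u] by blast
    then show "\<exists>a\<in>S \<inter> U. \<exists>b\<in>S \<inter> U. a \<noteq> b \<and> E u a \<and> E u b" using u R \<open>y \<notin> S\<close> by blast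
  qed
qed

lemma card_split: "finite S \<Longrightarrow> S \<subseteq> U \<union> P \<Longrightarrow> U \<inter> P = {} \<Longrightarrow> card S = card (S \<inter> U) + card (S \<inter> P)"
  by (subst card_Un_disjoint[symmetric]) (auto intro!: arg_cong[where f = card])

text \<open>The summand \<open>card (Q \<inter> {y})\<close> in \<open>low\<close> is what makes the
  increase exact: a set containing \<open>y\<close> spends one vertex too many in \<open>P\<close>,
  which is enough to put \<open>x\<close> into the old part; a set avoiding \<open>y\<close>
  dominates the old part unaided.\<close>

lemma gam2_pendant:
  assumes fin: "finite U" "finite P" and disj: "U \<inter> P = {}"
    and cut: "\<forall>u\<in>U. \<forall>p\<in>P. E u p \<longrightarrow> u = x \<and> p = y"
    and sym: "symp E"
    and Z: "Z \<subseteq> P" "dom2 E Z P" "card Z = c" and y: "y \<notin> U"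
    and low: "\<And>Q. Q \<subseteq> P \<Longrightarrow> dom2 E Q (P - {y}) \<Longrightarrow> c + card (Q \<inter> {y}) \<le> card Q"
  shows "gam2 E (U \<union> P) = gam2 E U + c"
proof (rule antisym)
  obtain S where S: "minset E U S" using minset_exists by blast
  have "gam2 E (U \<union> P) \<le> card (S \<union> Z)"
    using minsetD[OF S] Z by (intro gam2_le dom2_Un) auto
  also have "\<dots> \<le> card S + card Z" by (rule card_Un_le)
  finally show "gam2 E (U \<union> P) \<le> gam2 E U + c" using minsetD[OF S] Z by simp
next
  obtain S where "minset E (U \<union> P) S" using minset_exists by blast
  note S = minsetD[OF this]
  have finS: "finite S" using S(1) fin finite_subset by auto
  note dr = dom2_restrict[OF S(2,1) disj cut sym]
  have c: "c + card (S \<inter> P \<inter> {y}) \<le> card (S \<inter> P)" by (rule low) (use dr(2) in auto)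
  have "gam2 E U \<le> card (S \<inter> U) + card (S \<inter> P \<inter> {y})"
  proof (cases "y \<in> S \<inter> P")
    case False
    then have "dom2 E (S \<inter> U) U" using dr(3) y S(1) by blast
    then show ?thesis using gam2_le[of "S \<inter> U" U E] by simp
  next
    case True
    \<comment> \<open>The intersection with \<open>U\<close> is there because \<open>U\<close> will
      be an arbitrary subset of the old tree and may have lost \<open>x\<close>.\<close>
    have "dom2 E (insert x (S \<inter> U) \<inter> U) U"
      using dr(1) unfolding dom2_def by blast
    then have "gam2 E U \<le> card (insert x (S \<inter> U) \<inter> U)" by (intro gam2_le) auto
    also have "\<dots> \<le> card (insert x (S \<inter> U))" using finS by (intro card_mono) auto
    also have "\<dots> \<le> card (S \<inter> U) + 1" using finS by (simp add: card_insert_if)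
    finally show ?thesis using True by simp
  qed
  then show "gam2 E U + c \<le> gam2 E (U \<union> P)"
    using c card_split[OF finS S(1) disj] S(3) by simp
qed

lemma stable2_pendant_iff:
  assumes disj: "R \<inter> P = {}"
    and g: "\<And>U. U \<subseteq> R \<Longrightarrow> gam2 E (U \<union> P) = gam2 E U + c"
  shows "stable2 E (R \<union> P) \<longleftrightarrow>
    stable2 E R \<and> (\<forall>p\<in>P. gam2 E (R \<union> (P - {p})) = gam2 E R + c)"
proof -
  have "R \<union> P - {u} = (R - {u}) \<union> P" if "u \<in> R" for u using that disj by blast
  moreover have "R \<union> P - {p} = R \<union> (P - {p})" if "p \<in> P" for p using that disj by blast
  ultimately show ?thesis
    unfolding stable2_def ball_Un using g[of R] g by (simp cong: ball_cong)
qed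

section \<open>A pendant path on three vertices, joined by its centre\<close>

locale pendant_P3 =
  fixes E :: "'a \<Rightarrow> 'a \<Rightarrow> bool" and R :: "'a set" and x y l m :: 'a
  assumes fin: "finite R" and sym: "symp E"
    and dist: "l \<notin> R" "m \<notin> R" "y \<notin> R" "l \<noteq> m" "l \<noteq> y" "m \<noteq> y"
    and cut: "\<forall>u\<in>R. \<forall>p\<in>{l, y, m}. E u p \<longrightarrow> u = x \<and> p = y"
    and adj: "E y l" "E y m"
    and nbr: "\<And>p. p \<in> {l, y, m} \<Longrightarrow> E l p \<or> E m p \<Longrightarrow> p = y"
begin

lemma leaves_in:
  assumes "Q \<subseteq> {l, y, m}" "dom2 E Q D"
  shows "l \<in> D \<Longrightarrow> l \<in> Q" "m \<in> D \<Longrightarrow> m \<in> Q"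
proof -
  have "u \<in> Q" if "u \<in> D" "u = l \<or> u = m" for u
  proof (rule ccontr)
    assume "u \<notin> Q"
    then obtain v w where "v \<in> Q" "w \<in> Q" "v \<noteq> w" "E u v" "E u w"
      using dom2E[OF assms(2) \<open>u \<in> D\<close>] by blast
    moreover have "v' = y" if "v' \<in> Q" "E u v'" for v'
      using nbr[of v'] that \<open>u = l \<or> u = m\<close> assms(1) by blast
    ultimately show False by blast
  qed
  then show "l \<in> D \<Longrightarrow> l \<in> Q" "m \<in> D \<Longrightarrow> m \<in> Q" by blast+
qed

lemma gam2_Un:
  assumes "U \<subseteq> R"
  shows "gam2 E (U \<union> {l, y, m}) = gam2 E U + 2"
proof (rule gam2_pendant[where Z = "{l, m}" and x = x and y = y])
  show "dom2 E {l, m} {l, y, m}" using adj dist unfolding dom2_def by blast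
  fix Q assume Q: "Q \<subseteq> {l, y, m}" "dom2 E Q ({l, y, m} - {y})"
  then have "{l, m} \<subseteq> Q" using leaves_in dist by blast
  then have "Q = {l, m} \<or> Q = {l, y, m}" using Q by blast
  then show "2 + card (Q \<inter> {y}) \<le> card Q" using dist by auto
next
  show "finite U" using fin assms finite_subset by blast
  show "\<forall>u\<in>U. \<forall>p\<in>{l, y, m}. E u p \<longrightarrow> u = x \<and> p = y" using cut assms by blast
qed (use assms dist sym in auto)

text \<open>The deletion of a leaf decides; let \<open>q\<close> be the other leaf. If a minimum set
  of \<open>R\<close> contains \<open>x\<close>, adding \<open>q\<close> alone dominates
  \<open>y\<close> as well and saves a vertex. Otherwise a set using \<open>y\<close> pays 2 for
  \<open>y\<close> and \<open>q\<close> and by stability cannot save in \<open>R\<close>, while a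
  set avoiding \<open>y\<close> must contain \<open>x\<close>, hence is not minimum on
  \<open>R\<close> and loses there what it saved. The alternative \<open>R = {}\<close> admits the
  path on its own.\<close>

lemma not_minset_iff:
  assumes "E x y \<or> R = {}"
  shows "stable2 E (R \<union> {l, y, m}) \<longleftrightarrow> stable2 E R \<and> (\<forall>S. minset E R S \<longrightarrow> x \<notin> S)"
proof -
  have disj: "R \<inter> {l, y, m} = {}" using dist by blast
  have *: "gam2 E (R \<union> ({l, y, m} - {p})) = gam2 E R + 2 \<longleftrightarrow> (\<forall>S. minset E R S \<longrightarrow> x \<notin> S)"
    if stab: "stable2 E R" and p: "p \<in> {l, m}" for p
  proof -
    obtain q where q: "q \<in> {l, m}" "p \<noteq> q" "{l, y, m} - {p} = {y, q}"
      using p dist by (cases "p = l") auto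
    have qy: "q \<noteq> y" "q \<notin> R" "E y q" using q dist adj by auto
    have up: "gam2 E (R \<union> {y, q}) \<le> gam2 E R + 2"
    proof -
      obtain S where S: "minset E R S" using minset_exists by blast
      have "gam2 E (R \<union> {y, q}) \<le> card (S \<union> {y, q})"
        using minsetD[OF S] by (intro gam2_le dom2_Un) (auto simp: dom2_def)
      also have "\<dots> \<le> card S + card {y, q}" by (rule card_Un_le)
      finally show ?thesis using minsetD[OF S] qy by simp
    qed
    show ?thesis
      unfolding q(3)
    proof
      assume g: "gam2 E (R \<union> {y, q}) = gam2 E R + 2"
      show "\<forall>S. minset E R S \<longrightarrow> x \<notin> S"
      proof (intro allI impI notI)
        fix S assume S: "minset E R S" "x \<in> S"
        have "x \<in> R" using S minsetD by blast
        then have xy: "E y x" "x \<noteq> q" using assms sympD[OF sym] qy by auto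
        have "dom2 E (S \<union> {q}) (R \<union> {y, q})"
          using minsetD(2)[OF S(1)] S(2) qy xy unfolding dom2_def by blast
        then have "gam2 E (R \<union> {y, q}) \<le> card (S \<union> {q})"
          using minsetD(1)[OF S(1)] by (intro gam2_le) auto
        also have "\<dots> \<le> card S + 1" using card_Un_le[of S "{q}"] by simp
        finally show False using g minsetD(3)[OF S(1)] by simp
      qed
    next
      assume w: "\<forall>S. minset E R S \<longrightarrow> x \<notin> S"
      obtain S where "minset E (R \<union> {y, q}) S" using minset_exists by blast
      note S = minsetD[OF this]
      have finS: "finite S" using S(1) fin finite_subset by blast
      have disj': "R \<inter> {y, q} = {}" using dist qy by blast
      have cut': "\<forall>u\<in>R. \<forall>p\<in>{y, q}. E u p \<longrightarrow> u = x \<and> p = y"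
        using cut q(1) by blast
      have qn: "E q v \<Longrightarrow> v \<in> S \<Longrightarrow> v = y" for v
      proof -
        assume v: "E q v" "v \<in> S"
        have "v \<notin> R" using cut sympD[OF sym v(1)] q(1) qy(1) by blast
        then have "v \<in> {l, y, m}" using v(2) S(1) q(1) by blast
        then show "v = y" using nbr[of v] v(1) q(1) by blast
      qed
      note dr = dom2_restrict[OF S(2,1) disj' cut' sym]
      have "q \<in> S"
      proof (rule ccontr)
        assume "q \<notin> S"
        then obtain v w where "v \<in> S" "w \<in> S" "v \<noteq> w" "E q v" "E q w"
          using dom2E[OF S(2), of q] by blast
        then show False using qn[of v] qn[of w] by simp
      qed
      have "gam2 E R + 2 \<le> card (S \<inter> R) + card (S \<inter> {y, q})"
      proof (cases "y \<in> S")
        case True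
        then have "S \<inter> {y, q} = {y, q}" using \<open>q \<in> S\<close> by blast
        moreover have "gam2 E R \<le> card (S \<inter> R)"
          using stable2_gam2_le'[OF fin stab _ dr(1)] by blast
        ultimately show ?thesis using qy by simp
      next
        case False
        then obtain v w where "v \<in> S" "w \<in> S" "v \<noteq> w" "E y v" "E y w"
          using dom2E[OF S(2), of y] by blast
        then obtain v where v: "v \<in> S" "v \<noteq> q" "E y v" by blast
        then have "v \<in> R" using False S(1) by blast
        then have "x \<in> S \<inter> R" using cut v sympD[OF sym v(3)] by blast
        then have "\<not> minset E R (S \<inter> R)" using w by blast
        moreover have "dom2 E (S \<inter> R) R" using dr(3) False by blast
        ultimately have "gam2 E R < card (S \<inter> R)"
          using gam2_le[of "S \<inter> R" R E] unfolding minset_def by auto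
        moreover have "S \<inter> {y, q} = {q}" using \<open>q \<in> S\<close> False by blast
        ultimately show ?thesis by simp
      qed
      then show "gam2 E (R \<union> {y, q}) = gam2 E R + 2"
        using up card_split[OF finS S(1) disj'] S(3) by simp
    qed
  qed
  \<comment> \<open>Without the centre both leaves are isolated and forced, so this deletion imposes
    no condition on \<open>x\<close>.\<close>
  have y: "gam2 E (R \<union> ({l, y, m} - {y})) = gam2 E R + 2"
  proof -
    have e: "{l, y, m} - {y} = {l, m}" using dist by blast
    have "gam2 E (R \<union> {l, m}) = gam2 E R + 2"
    proof (rule gam2_pendant[where Z = "{l, m}" and x = x and y = y])
      fix Q assume Q: "Q \<subseteq> {l, m}" "dom2 E Q ({l, m} - {y})"
      then have "{l, m} \<subseteq> Q" using leaves_in[of Q "{l, m} - {y}"] dist by blast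
      then have "Q = {l, m}" using Q by blast
      then show "2 + card (Q \<inter> {y}) \<le> card Q" using dist by auto
    next
      show "\<forall>u\<in>R. \<forall>p\<in>{l, m}. E u p \<longrightarrow> u = x \<and> p = y" using cut by blast
    qed (use dist sym fin in \<open>auto simp: dom2_def\<close>)
    then show ?thesis using e by simp
  qed
  show ?thesis
    using stable2_pendant_iff[OF disj gam2_Un] * y by fast
qed

end

section \<open>A pendant spider with at least two legs, joined by its head\<close>

locale pendant_spider =
  fixes E :: "'a \<Rightarrow> 'a \<Rightarrow> bool" and R :: "'a set" and x y :: 'a
    and I :: "'i set" and a b c :: "'i \<Rightarrow> 'a" and P :: "'a set"
  assumes fin: "finite R" "finite I" and sym: "symp E"
    and P: "P = insert y (a ` I \<union> b ` I \<union> c ` I)" and disj: "R \<inter> P = {}"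
    and inj: "inj_on a I" "inj_on b I" "inj_on c I"
    and dist: "\<And>i j. i \<in> I \<Longrightarrow> j \<in> I \<Longrightarrow> a i \<noteq> b j \<and> a i \<noteq> c j \<and> b i \<noteq> c j"
      "\<And>i. i \<in> I \<Longrightarrow> a i \<noteq> y \<and> b i \<noteq> y \<and> c i \<noteq> y"
    and cut: "\<forall>u\<in>R. \<forall>p\<in>P. E u p \<longrightarrow> u = x \<and> p = y"
    and adj: "\<And>i. i \<in> I \<Longrightarrow> E y (a i) \<and> E (a i) (b i) \<and> E (b i) (c i)"
    and nbr: "\<And>i p. i \<in> I \<Longrightarrow> p \<in> P \<Longrightarrow> E (c i) p \<Longrightarrow> p = b i"
      "\<And>i p. i \<in> I \<Longrightarrow> p \<in> P \<Longrightarrow> E (b i) p \<Longrightarrow> p = a i \<or> p = c i"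
      "\<And>i p. i \<in> I \<Longrightarrow> p \<in> P \<Longrightarrow> E (a i) p \<Longrightarrow> p = y \<or> p = b i"
      "\<And>p. p \<in> P \<Longrightarrow> E y p \<Longrightarrow> p \<in> a ` I"
    and two: "2 \<le> card I"
begin

definition leg :: "'i \<Rightarrow> 'a set" where "leg i = {a i, b i, c i}"

lemma finP: "finite P" using P fin by simp

lemma leg_inter: "i \<in> I \<Longrightarrow> j \<in> I \<Longrightarrow> i \<noteq> j \<Longrightarrow> leg i \<inter> leg j = {}"
  using inj dist unfolding leg_def by (auto dest: inj_onD)

lemma card_legs:
  assumes "Q \<subseteq> P"
  shows "card Q = card (Q \<inter> {y}) + (\<Sum>i\<in>I. card (Q \<inter> leg i))"
proof -
  have Q: "Q = (Q \<inter> {y}) \<union> (\<Union>i\<in>I. Q \<inter> leg i)" using assms P unfolding leg_def by blast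
  have "card (\<Union>i\<in>I. Q \<inter> leg i) = (\<Sum>i\<in>I. card (Q \<inter> leg i))"
    using fin leg_inter by (intro card_UN_disjoint) (auto simp: leg_def)
  moreover have "card ((Q \<inter> {y}) \<union> (\<Union>i\<in>I. Q \<inter> leg i)) =
      card (Q \<inter> {y}) + card (\<Union>i\<in>I. Q \<inter> leg i)"
    using fin dist(2) by (intro card_Un_disjoint) (auto simp: leg_def)
  ultimately show ?thesis using Q by simp
qed

text \<open>The end \<open>c i\<close> is forced, since \<open>b i\<close> is its only neighbour in
  \<open>P\<close>; and \<open>b i\<close> is either chosen or needs \<open>a i\<close>.\<close>

lemma leg_ge_2:
  assumes "Q \<subseteq> P" "dom2 E Q D" "i \<in> I" "b i \<in> D" "c i \<in> D"
  shows "2 \<le> card (Q \<inter> leg i)"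
proof -
  have ci: "c i \<in> Q" using assms nbr(1)[of i] unfolding dom2_def by blast
  have "b i \<in> Q \<or> a i \<in> Q"
  proof (rule ccontr)
    assume *: "\<not> (b i \<in> Q \<or> a i \<in> Q)"
    then obtain v w where "v \<in> Q" "w \<in> Q" "v \<noteq> w" "E (b i) v" "E (b i) w"
      using dom2E[OF assms(2,4)] by blast
    then show False using nbr(2)[of i] assms * by blast
  qed
  then obtain d where "d \<in> Q \<inter> leg i" "d \<noteq> c i" using dist assms(3) unfolding leg_def by blast
  then have "card {d, c i} \<le> card (Q \<inter> leg i)"
    using ci by (intro card_mono) (auto simp: leg_def)
  then show ?thesis using \<open>d \<noteq> c i\<close> by simp
qed

lemma low:
  assumes "Q \<subseteq> P" "dom2 E Q D" "b ` I \<union> c ` I \<subseteq> D"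
  shows "2 * card I + card (Q \<inter> {y}) \<le> card Q"
proof -
  have "(\<Sum>i\<in>I. 2) \<le> (\<Sum>i\<in>I. card (Q \<inter> leg i))"
    using leg_ge_2[OF assms(1,2)] assms(3) by (intro sum_mono) auto
  then show ?thesis using card_legs[OF assms(1)] by simp
qed

text \<open>Only deleting \<open>b j\<close> or \<open>c j\<close> damages the count. The survivor
  \<open>q\<close> of these two is then forced, and \<open>a j\<close> is either chosen or needs
  \<open>y\<close>. Since \<open>y\<close> may be the second vertex paid for this leg, the bonus for
  \<open>y\<close> present in \<open>low\<close> is lost here.\<close>

lemma low_del:
  assumes Q: "Q \<subseteq> P - {p}" and d: "dom2 E Q (P - {p} - {y})" and p: "p \<in> P"
  shows "2 * card I \<le> card Q"
proof (cases "\<exists>j\<in>I. p = b j \<or> p = c j")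
  case False
  then have "b ` I \<union> c ` I \<subseteq> P - {p} - {y}" using P dist by auto
  then show ?thesis using low[OF _ d] Q by fastforce
next
  case True
  then obtain j where j: "j \<in> I" "p = b j \<or> p = c j" by blast
  have QP: "Q \<subseteq> P" using Q by blast
  have "(\<Sum>i\<in>I - {j}. 2) \<le> (\<Sum>i\<in>I - {j}. card (Q \<inter> leg i))"
  proof (rule sum_mono)
    fix i assume i: "i \<in> I - {j}"
    have "b i \<noteq> b j" "c i \<noteq> c j" "b i \<noteq> c j" "c i \<noteq> b j"
      using i j dist inj by (metis DiffE inj_onD insertI1)+
    then have "b i \<in> P - {p} - {y}" "c i \<in> P - {p} - {y}"
      using i j P dist by auto
    then show "2 \<le> card (Q \<inter> leg i)" using leg_ge_2[OF QP d] i by blast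
  qed
  moreover have "2 \<le> card (Q \<inter> {y}) + card (Q \<inter> leg j)"
  proof -
    have ex: "\<exists>v. v \<in> Q \<and> v \<noteq> w \<and> E u v" if "u \<in> P - {p} - {y}" "u \<notin> Q" for u w
      using dom2E[OF d that] by metis
    obtain q where q: "q = (if p = b j then c j else b j)" by blast
    have qp: "q \<in> P - {p} - {y}" "a j \<in> P - {p} - {y}"
      using q j P dist(1)[of j j] dist(2)[of j] by (auto split: if_splits)
    have ajn: "E (a j) v \<Longrightarrow> v \<in> Q \<Longrightarrow> v \<noteq> y \<Longrightarrow> v = b j" for v
      using nbr(3)[of j v] j QP by blast
    have qQ: "q \<in> Q"
    proof (rule ccontr)
      assume "q \<notin> Q"
      from ex[OF qp(1) this, of "a j"] obtain v where "v \<in> Q" "v \<noteq> a j" "E q v" by blast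
      then show False using nbr(1,2)[of j v] j q QP Q by (auto split: if_splits)
    qed
    have "y \<in> Q \<or> a j \<in> Q"
    proof (rule ccontr)
      assume *: "\<not> (y \<in> Q \<or> a j \<in> Q)"
      then show False using ex[OF qp(2), of "b j"] ajn by blast
    qed
    moreover have "finite (Q \<inter> leg j)" "q \<in> leg j" "a j \<in> leg j" "q \<noteq> a j"
      using q j dist(1)[of j j] by (auto simp: leg_def)
    ultimately show ?thesis
    proof (elim disjE)
      assume "y \<in> Q"
      moreover have "0 < card (Q \<inter> leg j)"
        using \<open>finite (Q \<inter> leg j)\<close> \<open>q \<in> leg j\<close> qQ by (subst card_gt_0_iff) blast
      ultimately show ?thesis by simp
    next
      assume "a j \<in> Q"
      then have "card {q, a j} \<le> card (Q \<inter> leg j)"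
        using \<open>finite (Q \<inter> leg j)\<close> \<open>q \<in> leg j\<close> \<open>a j \<in> leg j\<close> qQ by (intro card_mono) auto
      then show ?thesis using \<open>q \<noteq> a j\<close> by simp
    qed
  qed
  moreover have "(\<Sum>i\<in>I. card (Q \<inter> leg i)) = card (Q \<inter> leg j) + (\<Sum>i\<in>I - {j}. card (Q \<inter> leg i))"
    by (rule sum.remove[OF fin(2) j(1)])
  moreover have "card I = card (I - {j}) + 1" using card_Suc_Diff1[OF fin(2) j(1)] by simp
  ultimately show ?thesis using card_legs[OF QP] by simp
qed

lemma gam2_Un:
  assumes "U \<subseteq> R"
  shows "gam2 E (U \<union> P) = gam2 E U + 2 * card I"
\<comment> \<open>The first and last vertices of the legs dominate every middle vertex; the head
  sees two first vertices because there are two legs.\<close>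
proof (rule gam2_pendant[where Z = "a ` I \<union> c ` I" and x = x and y = y])
  show "finite U" using fin assms finite_subset by blast
  show "U \<inter> P = {}" using assms disj by blast
  show "finite P" by (rule finP)
  show "y \<notin> U" using assms disj P by blast
  show "a ` I \<union> c ` I \<subseteq> P" using P by blast
  have "card (a ` I \<union> c ` I) = card (a ` I) + card (c ` I)"
    using fin dist(1) by (intro card_Un_disjoint) blast+
  then show "card (a ` I \<union> c ` I) = 2 * card I" using inj by (simp add: card_image)
  show "dom2 E (a ` I \<union> c ` I) P"
    unfolding dom2_def
  proof
    fix u assume u: "u \<in> P - (a ` I \<union> c ` I)"
    show "\<exists>v\<in>a ` I \<union> c ` I. \<exists>w\<in>a ` I \<union> c ` I. v \<noteq> w \<and> E u v \<and> E u w"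
    proof (cases "u = y")
      case True
      obtain i j where "i \<in> I" "j \<in> I" "i \<noteq> j"
        using two card_le_Suc0_iff_eq[OF fin(2)] by fastforce
      then show ?thesis using True adj inj by (metis UnI1 image_eqI inj_onD)
    next
      case False
      then obtain i where i: "i \<in> I" "u = b i" using u P by blast
      then have "E u (a i)" "E u (c i)" "a i \<noteq> c i" using adj sympD[OF sym] dist by auto
      then show ?thesis using i by blast
    qed
  qed
next
  show "\<forall>u\<in>U. \<forall>p\<in>P. E u p \<longrightarrow> u = x \<and> p = y" using cut assms by blast
next
  fix Q assume Q: "Q \<subseteq> P" "dom2 E Q (P - {y})"
  show "2 * card I + card (Q \<inter> {y}) \<le> card Q"
    by (rule low[OF Q]) (use P dist in auto)
qed (rule sym)

text \<open>Start from the first and last vertices of all legs; if one of them is deleted, the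
  middle vertex of its leg replaces it at equal cost. The head may thereby lose one chosen
  neighbour, and \<open>side\<close> guarantees that two remain.\<close>

lemma gam2_del_le:
  assumes S0: "minset E R S0" and p: "p \<in> P"
    and side: "3 \<le> card I \<or> E x y \<and> x \<in> S0"
  shows "gam2 E (R \<union> (P - {p})) \<le> gam2 E R + 2 * card I"
proof -
  let ?Q0 = "a ` I \<union> c ` I"
  \<comment> \<open>The choice is unambiguous: the legs are disjoint, so \<open>p\<close> determines
    its leg.\<close>
  define Q where "Q = (if p \<in> ?Q0 then insert (b (SOME j. j \<in> I \<and> (p = a j \<or> p = c j))) (?Q0 - {p}) else ?Q0)"
  have cQ0: "card ?Q0 \<le> 2 * card I"
    using card_Un_le[of "a ` I" "c ` I"] inj by (simp add: card_image)
  have Q: "?Q0 - {p} \<subseteq> Q" "p \<notin> Q" "Q \<subseteq> P" "card Q \<le> 2 * card I" "\<And>j. j \<in> I \<Longrightarrow> p = a j \<or> p = c j \<Longrightarrow> b j \<in> Q"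
  proof -
    have "b (SOME j. j \<in> I \<and> (p = a j \<or> p = c j)) = b j" if "j \<in> I" "p = a j \<or> p = c j" for j
    proof -
      have "(SOME j. j \<in> I \<and> (p = a j \<or> p = c j)) = j"
        using that inj dist(1) by (intro some_equality) (auto dest: inj_onD, metis+)
      then show ?thesis by simp
    qed
    note some = this
    show "?Q0 - {p} \<subseteq> Q" unfolding Q_def by auto
    show b: "b j \<in> Q" if "j \<in> I" "p = a j \<or> p = c j" for j
      using some[OF that] that unfolding Q_def by auto
    show "Q \<subseteq> P" "p \<notin> Q"
    proof -
      have "p \<notin> Q \<and> Q \<subseteq> P"
      proof (cases "p \<in> ?Q0")
        case True
        then obtain j where j: "j \<in> I" "p = a j \<or> p = c j" by blast
        have "Q = insert (b j) (?Q0 - {p})" unfolding Q_def using True some[OF j] by simp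
        moreover have "b j \<noteq> p" using j dist(1)[of j j] by auto
        ultimately show ?thesis using P j by auto
      qed (use P in \<open>auto simp: Q_def\<close>)
      then show "Q \<subseteq> P" "p \<notin> Q" by auto
    qed
    show "card Q \<le> 2 * card I"
    proof (cases "p \<in> ?Q0")
      case True
      have "card (insert z (?Q0 - {p})) \<le> card ?Q0" for z
        using True fin card_Suc_Diff1[of ?Q0 p] by (simp add: card_insert_if)
      then show ?thesis using cQ0 True unfolding Q_def by (simp only: if_True) (rule order_trans)
    qed (use cQ0 in \<open>simp add: Q_def\<close>)
  qed
  have "dom2 E (S0 \<union> Q) (R \<union> (P - {p}))"
    unfolding dom2_def
  proof
    fix u assume u: "u \<in> R \<union> (P - {p}) - (S0 \<union> Q)"
    show "\<exists>v\<in>S0 \<union> Q. \<exists>w\<in>S0 \<union> Q. v \<noteq> w \<and> E u v \<and> E u w"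
    proof (cases "u \<in> R")
      case True
      then show ?thesis using u minsetD(2)[OF S0] unfolding dom2_def by blast
    next
      case False
      then have "u \<in> P - {p}" "u \<notin> ?Q0" using u Q(1) by auto
      then consider i where "i \<in> I" "u = b i" | "u = y" using P by blast
      then show ?thesis
      proof cases
        case 1
        then have "E u (a i)" "E u (c i)" "a i \<noteq> c i" using adj sympD[OF sym] dist by auto
        moreover have "a i \<noteq> p" "c i \<noteq> p" using Q(5)[of i] u 1 by auto
        ultimately show ?thesis using 1 Q(1) by blast
      next
        case 2
        define J where "J = {i \<in> I. a i \<noteq> p}"
        have J: "a i \<in> Q" "E u (a i)" if "i \<in> J" for i
          using that Q(1) adj 2 unfolding J_def by auto
        have "card I \<le> card J + 1"
        proof (cases "\<exists>j\<in>I. a j = p")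
          case True
          then obtain j where "j \<in> I" "a j = p" by blast
          then have "I \<subseteq> insert j J" using inj unfolding J_def inj_on_def by blast
          then have "card I \<le> card (insert j J)" using fin by (intro card_mono) (auto simp: J_def)
          also have "\<dots> \<le> card J + 1" using fin by (simp add: card_insert_if J_def)
          finally show ?thesis .
        next
          case False
          then have "J = I" unfolding J_def by blast
          then show ?thesis by simp
        qed
        show ?thesis
        proof (cases "3 \<le> card I")
          case True
          then have "2 \<le> card J" using \<open>card I \<le> card J + 1\<close> by simp
          then obtain i j where "i \<in> J" "j \<in> J" "i \<noteq> j"
            using card_le_Suc0_iff_eq[of J] fin unfolding J_def by fastforce
          then have "a i \<noteq> a j" using inj unfolding J_def inj_on_def by blast
          then show ?thesis using J \<open>i \<in> J\<close> \<open>j \<in> J\<close> by blast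
        next
          case False
          then have "E u x" "x \<in> S0" using side sympD[OF sym] 2 by auto
          moreover have "J \<noteq> {}" using two \<open>card I \<le> card J + 1\<close> by auto
          then obtain i where "i \<in> J" by blast
          moreover have "a i \<noteq> x"
            using \<open>i \<in> J\<close> \<open>x \<in> S0\<close> minsetD(1)[OF S0] disj P unfolding J_def by blast
          ultimately show ?thesis using J by blast
        qed
      qed
    qed
  qed
  then have "gam2 E (R \<union> (P - {p})) \<le> card (S0 \<union> Q)"
    using minsetD(1)[OF S0] Q by (intro gam2_le) auto
  also have "\<dots> \<le> card S0 + card Q" by (rule card_Un_le)
  finally show ?thesis using minsetD(3)[OF S0] Q by simp
qed

text \<open>Because \<open>low_del\<close> gives no bonus for a chosen \<open>y\<close>, the old
  part can only be assumed to dominate \<open>R - {x}\<close>; stability of \<open>R\<close> makes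
  that as expensive as dominating \<open>R\<close>.\<close>

lemma gam2_del_ge:
  assumes stab: "stable2 E R" and p: "p \<in> P"
  shows "gam2 E R + 2 * card I \<le> gam2 E (R \<union> (P - {p}))"
proof -
  obtain S where "minset E (R \<union> (P - {p})) S" using minset_exists by blast
  note S = minsetD[OF this]
  have finS: "finite S" using S(1) fin finP finite_subset by auto
  have disj': "R \<inter> (P - {p}) = {}" using disj by blast
  have cut': "\<forall>u\<in>R. \<forall>q\<in>P - {p}. E u q \<longrightarrow> u = x \<and> q = y"
    using cut by blast
  note dr = dom2_restrict[OF S(2,1) disj' cut' sym]
  have "gam2 E R \<le> card (S \<inter> R)"
    using stable2_gam2_le'[OF fin(1) stab _ dr(1)] by blast
  moreover have "2 * card I \<le> card (S \<inter> (P - {p}))"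
    by (rule low_del[OF _ dr(2) p]) blast
  ultimately show ?thesis using card_split[OF finS S(1) disj'] S(3) by simp
qed

text \<open>For two legs the necessity of the side condition comes from deleting the first vertex
  \<open>a j\<close> of a leg. All \<open>b\<close> and \<open>c\<close> survive, so
  \<open>low\<close> still charges for \<open>y\<close>, and the exact total leaves no room for it.
  Hence \<open>y\<close> is unchosen and needs \<open>a i\<close> and \<open>x\<close>, and what
  remains in \<open>R\<close> is a minimum set containing \<open>x\<close>.\<close>

lemma stable_iff:
  assumes "3 \<le> card I \<or> E x y"
  shows "stable2 E (R \<union> P) \<longleftrightarrow> stable2 E R \<and> (3 \<le> card I \<or> (\<exists>S. minset E R S \<and> x \<in> S))"
proof
  assume *: "stable2 E R \<and> (3 \<le> card I \<or> (\<exists>S. minset E R S \<and> x \<in> S))"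
  obtain S0 where S0: "minset E R S0" "3 \<le> card I \<or> E x y \<and> x \<in> S0"
    using * assms minset_exists by blast
  have "gam2 E (R \<union> (P - {p})) = gam2 E R + 2 * card I" if "p \<in> P" for p
    using gam2_del_le[OF S0(1) that S0(2)] gam2_del_ge[OF _ that] * by simp
  then show "stable2 E (R \<union> P)" using stable2_pendant_iff[OF disj gam2_Un] * by blast
next
  assume stab: "stable2 E (R \<union> P)"
  then have R: "stable2 E R" using stable2_pendant_iff[OF disj gam2_Un] by blast
  have "\<exists>S. minset E R S \<and> x \<in> S" if k: "\<not> 3 \<le> card I"
  proof -
    have "card I = 2" using k two by simp
    then obtain i j where I: "I = {i, j}" "i \<noteq> j" by (meson card_2_iff)
    have aj: "a j \<in> R \<union> P" using I P by auto
    obtain S where S: "S \<subseteq> R \<union> P - {a j}" "dom2 E S (R \<union> P - {a j})" "card S = gam2 E (R \<union> P)"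
      using stable2_minset_del[OF stab aj] by blast
    have "R \<union> P - {a j} = R \<union> (P - {a j})" using disj I P by blast
    note S = S[unfolded this]
    have finS: "finite S" using S(1) fin finP finite_subset by auto
    have disj': "R \<inter> (P - {a j}) = {}" using disj by blast
    have cut': "\<forall>u\<in>R. \<forall>q\<in>P - {a j}. E u q \<longrightarrow> u = x \<and> q = y"
      using cut by blast
    note dr = dom2_restrict[OF S(2,1) disj' cut' sym]
    have "b i' \<noteq> a j" "c i' \<noteq> a j" "b i' \<noteq> y" "c i' \<noteq> y" if "i' \<in> I" for i'
      using dist(1)[of j i'] dist(2)[OF that] that I by auto
    then have "b ` I \<union> c ` I \<subseteq> P - {a j} - {y}" using P by auto
    from low[OF _ dr(2) this]
    have lowP: "2 * card I + card (S \<inter> (P - {a j}) \<inter> {y}) \<le> card (S \<inter> (P - {a j}))" by blast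
    have tot: "card (S \<inter> R) + card (S \<inter> (P - {a j})) = gam2 E R + 2 * card I"
      using card_split[OF finS S(1) disj'] S(3) gam2_Un[of R] by simp
    have geR: "gam2 E R \<le> card (S \<inter> R)"
      using stable2_gam2_le'[OF fin(1) R _ dr(1)] by blast
    have y: "y \<in> P - {a j}" using P dist(2)[of j] I by auto
    have "y \<notin> S"
    proof
      assume "y \<in> S"
      then have "S \<inter> (P - {a j}) \<inter> {y} = {y}" using y by blast
      then show False using lowP tot geR by simp
    qed
    then obtain v w where vw: "v \<in> S" "w \<in> S" "v \<noteq> w" "E y v" "E y w"
      using dom2E[OF S(2), of y] y by blast
    then obtain v where v: "v \<in> S" "E y v" "v \<noteq> a i" by blast
    have "v \<in> R"
    proof (rule ccontr)
      assume "v \<notin> R"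
      then have "v \<in> P - {a j}" using v S(1) by blast
      then show False using nbr(4)[of v] v I by blast
    qed
    then have "x \<in> S \<inter> R" using cut v sympD[OF sym v(2)] y by blast
    moreover have "minset E R (S \<inter> R)"
      using dr(3)[OF \<open>y \<notin> S\<close>] gam2_le[of "S \<inter> R" R E] lowP tot geR unfolding minset_def by simp
    ultimately show ?thesis by blast
  qed
  then show "stable2 E R \<and> (3 \<le> card I \<or> (\<exists>S. minset E R S \<and> x \<in> S))" using R by blast
qed

end

section \<open>Stable graphs near their leaves\<close>

definition nb :: "('a \<Rightarrow> 'a \<Rightarrow> bool) \<Rightarrow> 'a set \<Rightarrow> 'a \<Rightarrow> 'a set" where
  "nb E V u = {v \<in> V. E u v}"

locale stable_graph =
  fixes E :: "'a \<Rightarrow> 'a \<Rightarrow> bool" and V :: "'a set"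
  assumes fin: "finite V" and sym: "symp E" and irr: "irreflp E" and stab: "stable2 E V"
begin

lemma nb_sym: "u \<in> V \<Longrightarrow> v \<in> nb E V u \<Longrightarrow> u \<in> nb E V v"
  using sympD[OF sym] unfolding nb_def by blast

lemma nb_in: "v \<in> nb E V u \<Longrightarrow> v \<in> V" "v \<in> nb E V u \<Longrightarrow> E u v" "v \<in> V \<Longrightarrow> E u v \<Longrightarrow> v \<in> nb E V u"
  unfolding nb_def by auto

lemma nb_irr: "u \<notin> nb E V u"
  using irreflpD[OF irr] unfolding nb_def by blast

lemma minset_finite: "minset E V S \<Longrightarrow> finite S"
  by (rule finite_subset[OF minsetD(1) fin])

lemma dom2_nb:
  assumes "dom2 E S D" "u \<in> D" "u \<notin> S" "S \<subseteq> V"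
  obtains a b where "a \<in> S" "b \<in> S" "a \<noteq> b" "a \<in> nb E V u" "b \<in> nb E V u"
proof -
  obtain a b where "a \<in> S" "b \<in> S" "a \<noteq> b" "E u a" "E u b"
    using dom2E[OF assms(1-3)] .
  then show thesis using that[of a b] assms(4) unfolding nb_def by auto
qed

lemma dom2_nbI:
  assumes "\<And>u. u \<in> D \<Longrightarrow> u \<notin> S \<Longrightarrow> \<exists>a\<in>S. \<exists>b\<in>S. a \<noteq> b \<and> a \<in> nb E V u \<and> b \<in> nb E V u"
  shows "dom2 E S D"
  unfolding dom2_def
proof
  fix u assume "u \<in> D - S"
  then obtain a b where "a \<in> S" "b \<in> S" "a \<noteq> b" "a \<in> nb E V u" "b \<in> nb E V u"
    using assms[of u] by blast
  then show "\<exists>a\<in>S. \<exists>b\<in>S. a \<noteq> b \<and> E u a \<and> E u b" using nb_in(2) by blast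
qed

lemma in_minset:
  assumes "dom2 E S D" "u \<in> D" "S \<subseteq> V" "nb E V u \<inter> S \<subseteq> {s}"
  shows "u \<in> S"
proof (rule ccontr)
  assume "u \<notin> S"
  from dom2_nb[OF assms(1,2) this assms(3)] obtain a b where
    "a \<in> S" "b \<in> S" "a \<noteq> b" "a \<in> nb E V u" "b \<in> nb E V u" by blast
  then have "a \<in> nb E V u \<inter> S" "b \<in> nb E V u \<inter> S" by auto
  then show False using assms(4) \<open>a \<noteq> b\<close> by blast
qed

text \<open>A minimum set stays 2-dominating under deletion of \<open>p \<in> S\<close> unless some vertex relies on \<open>p\<close>;
  stability says that the latter happens for every \<open>p\<close>.\<close>

lemma minset_needed:
  assumes S: "minset E V S" and p: "p \<in> S"
  obtains u where "u \<in> nb E V p" "u \<notin> S"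
    "\<And>a b. a \<in> S - {p} \<Longrightarrow> b \<in> S - {p} \<Longrightarrow> a \<in> nb E V u \<Longrightarrow> b \<in> nb E V u \<Longrightarrow> a = b"
proof -
  note S' = minsetD[OF S]
  have pV: "p \<in> V" using S' p by blast
  have "\<not> dom2 E (S - {p}) (V - {p})"
  proof
    assume "dom2 E (S - {p}) (V - {p})"
    then have "gam2 E V \<le> card (S - {p})"
      using S'(1) by (intro stable2_gam2_le[OF stab pV]) auto
    also have "\<dots> < card S" using card_Diff1_less[OF minset_finite[OF S] p] .
    finally show False using S'(3) by simp
  qed
  then obtain u where u: "u \<in> V" "u \<notin> S"
    and no: "\<And>a b. a \<in> S - {p} \<Longrightarrow> b \<in> S - {p} \<Longrightarrow> a \<in> nb E V u \<Longrightarrow> b \<in> nb E V u \<Longrightarrow> a = b"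
    using dom2_nbI[of "V - {p}" "S - {p}"] by blast
  obtain a b where ab: "a \<in> S" "b \<in> S" "a \<noteq> b" "a \<in> nb E V u" "b \<in> nb E V u"
    using dom2_nb[OF S'(2) u S'(1)] .
  then have "p \<in> nb E V u" using no[of a b] by blast
  then have "u \<in> nb E V p" using nb_sym u(1) by blast
  then show thesis using that[of u] u no by blast
qed

text \<open>An isolated vertex is in every minimum set, but no neighbour can rely on it.\<close>

lemma nb_nonempty:
  assumes "u \<in> V"
  shows "nb E V u \<noteq> {}"
proof
  assume e: "nb E V u = {}"
  obtain S where S: "minset E V S" using minset_exists by blast
  note S' = minsetD[OF S]
  have "u \<in> S" using in_minset[OF S'(2) assms S'(1), of u] e by blast
  from minset_needed[OF S this] obtain v where "v \<in> nb E V u" .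
  then show False using e by simp
qed

lemma leaf_in:
  assumes "l \<in> D" "nb E V l = {s}" "dom2 E S D" "S \<subseteq> V"
  shows "l \<in> S"
  using in_minset[of S D l s] assms by blast

text \<open>The leaf is forced into \<open>S\<close>, so by \<open>minset_needed\<close> some
  neighbour relies on it, and the only candidate is \<open>s\<close>. Hence \<open>s\<close> is
  unchosen and has at most one chosen neighbour besides \<open>l\<close>.\<close>

lemma leaf_support:
  assumes l: "l \<in> V" "nb E V l = {s}" and S: "minset E V S"
  shows "s \<notin> S"
    and "\<And>a b. a \<in> S \<Longrightarrow> b \<in> S \<Longrightarrow> a \<in> nb E V s \<Longrightarrow> b \<in> nb E V s \<Longrightarrow> a \<noteq> b \<Longrightarrow> a = l \<or> b = l"
proof -
  note S' = minsetD[OF S]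
  have "l \<in> S" using leaf_in[OF l S'(2,1)] .
  then obtain u where u: "u \<in> nb E V l" "u \<notin> S"
    "\<And>a b. a \<in> S - {l} \<Longrightarrow> b \<in> S - {l} \<Longrightarrow> a \<in> nb E V u \<Longrightarrow> b \<in> nb E V u \<Longrightarrow> a = b"
    using minset_needed[OF S] by metis
  have us: "u = s" using u(1) l(2) by blast
  show "s \<notin> S" using u(2) us by blast
  show "a = l \<or> b = l" if "a \<in> S" "b \<in> S" "a \<in> nb E V s" "b \<in> nb E V s" "a \<noteq> b" for a b
    using u(3)[of a b] that us by blast
qed

lemma not_three_leaves:
  assumes "l \<in> V" "m \<in> V" "q \<in> V" "nb E V l = {s}" "nb E V m = {s}" "nb E V q = {s}" "l \<noteq> m" "m \<noteq> q" "q \<noteq> l"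
  shows False
proof -
  obtain S where S: "minset E V S" using minset_exists by blast
  note S' = minsetD[OF S]
  have "m \<in> S" "q \<in> S" using leaf_in S' assms by blast+
  moreover have "m \<in> nb E V s" "q \<in> nb E V s" using nb_sym assms by blast+
  ultimately show False using leaf_support(2)[OF assms(1,4) S] assms by blast
qed

text \<open>\<open>stub l v w\<close>: the path \<open>l v\<close> hangs off \<open>w\<close>; \<open>tail3 l v w h\<close>: the path \<open>l v w\<close> hangs off \<open>h\<close>.\<close>

definition stub :: "'a \<Rightarrow> 'a \<Rightarrow> 'a \<Rightarrow> bool" where
  "stub l v w \<longleftrightarrow> l \<in> V \<and> v \<in> V \<and> w \<in> V \<and> l \<noteq> w \<and> nb E V l = {v} \<and> nb E V v = {l, w}"

definition tail3 :: "'a \<Rightarrow> 'a \<Rightarrow> 'a \<Rightarrow> 'a \<Rightarrow> bool" where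
  "tail3 l v w h \<longleftrightarrow> stub l v w \<and> h \<in> V \<and> v \<noteq> h \<and> nb E V w = {v, h}"

lemma stubD:
  assumes "stub l v w"
  shows "l \<in> V" "v \<in> V" "w \<in> V" "l \<noteq> w" "nb E V l = {v}" "nb E V v = {l, w}" "l \<noteq> v" "v \<noteq> w"
  using assms nb_irr[of v] unfolding stub_def by auto

text \<open>As a neighbour of a leaf, \<open>v\<close> is unchosen; having only two neighbours, it
  needs both.\<close>

lemma stub_minset:
  assumes st: "stub l v w" and S: "minset E V S"
  shows "l \<in> S" "v \<notin> S" "w \<in> S"
proof -
  note st' = stubD[OF st] and S' = minsetD[OF S]
  show "l \<in> S" using leaf_in[OF st'(1,5) S'(2,1)] .
  show v: "v \<notin> S" using leaf_support(1)[OF st'(1,5) S] .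
  from dom2_nb[OF S'(2) st'(2) v S'(1)] obtain a b where
    "a \<in> S" "b \<in> S" "a \<noteq> b" "a \<in> nb E V v" "b \<in> nb E V v" by blast
  then show "w \<in> S" using st'(6) by auto
qed

lemma stub_not_leaf:
  assumes "stub l v w" "q \<in> V" "nb E V q = {w}"
  shows False
proof -
  obtain S where S: "minset E V S" using minset_exists by blast
  show False using stub_minset(3)[OF assms(1) S] leaf_support(1)[OF assms(2,3) S] by blast
qed

text \<open>Delete \<open>w\<close>: both stubs become isolated edges, so a minimum set of the rest
  contains all four of their vertices. Trading \<open>v\<close> and \<open>v'\<close> for
  \<open>w\<close> dominates the whole graph with one vertex fewer, although by stability both
  values agree.\<close>

lemma stub_unique:
  assumes st: "stub l v w" "stub l' v' w"
  shows "v = v'"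
proof (rule ccontr)
  assume ne: "v \<noteq> v'"
  note s1 = stubD[OF st(1)] and s2 = stubD[OF st(2)]
  obtain S where S: "S \<subseteq> V - {w}" "dom2 E S (V - {w})" "card S = gam2 E V"
    using stable2_minset_del[OF stab s1(3)] by blast
  have SV: "S \<subseteq> V" and finS: "finite S" using S(1) fin finite_subset by blast+
  have in_S: "l \<in> S" "v \<in> S" if "stub l v w" for l v
  proof -
    note s = stubD[OF that]
    show "l \<in> S" using in_minset[OF S(2) _ SV, of l v] s by blast
    show "v \<in> S" using in_minset[OF S(2) _ SV, of v l] s S(1) by blast
  qed
  have l: "l \<in> S" "v \<in> S" "l' \<in> S" "v' \<in> S" using in_S st by blast+
  define S' where "S' = insert w (S - {v, v'})"
  have S'l: "l \<in> S'" "l' \<in> S'" "w \<in> S'" "v \<notin> S'" "v' \<notin> S'"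
    using l s1 s2 ne unfolding S'_def by auto
  have "dom2 E S' V"
  proof (rule dom2_nbI)
    fix u assume u: "u \<in> V" "u \<notin> S'"
    consider "u = v" | "u = v'" | "u \<noteq> v" "u \<noteq> v'" by blast
    then show "\<exists>a\<in>S'. \<exists>b\<in>S'. a \<noteq> b \<and> a \<in> nb E V u \<and> b \<in> nb E V u"
    proof cases
      case 1
      then have "l \<in> nb E V u" "w \<in> nb E V u" using s1(6) by simp_all
      then show ?thesis using S'l(1,3) s1(4) by blast
    next
      case 2
      then have "l' \<in> nb E V u" "w \<in> nb E V u" using s2(6) by simp_all
      then show ?thesis using S'l(2,3) s2(4) by blast
    next
      case 3
      then have uS: "u \<notin> S" "u \<in> V - {w}" using u unfolding S'_def by auto
      obtain a b where ab: "a \<in> S" "b \<in> S" "a \<noteq> b" "a \<in> nb E V u" "b \<in> nb E V u"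
        using dom2_nb[OF S(2) uS(2,1) SV] by blast
      have "v \<notin> nb E V u" "v' \<notin> nb E V u"
        using nb_sym[OF u(1), of v] nb_sym[OF u(1), of v'] s1(6) s2(6) l uS by auto
      then have "a \<in> S'" "b \<in> S'" using ab unfolding S'_def by auto
      then show ?thesis using ab by blast
    qed
  qed
  then have "gam2 E V \<le> card S'" using SV s1 unfolding S'_def by (intro gam2_le) auto
  also have "card S' < card S"
  proof -
    have "card (S - {v, v'}) = card S - 2" using l ne finS by (simp add: card_Diff_subset)
    moreover have "2 \<le> card S" using card_mono[OF finS, of "{v, v'}"] l ne by simp
    moreover have "card S' \<le> Suc (card (S - {v, v'}))"
      unfolding S'_def using finS by (simp add: card_insert_if)
    ultimately show ?thesis by linarith
  qed
  finally show False using S(3) by simp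
qed

lemma tail3D:
  assumes "tail3 l v w h"
  shows "stub l v w" "h \<in> V" "v \<noteq> h" "nb E V w = {v, h}" "w \<noteq> h" "l \<noteq> h"
proof -
  show s: "stub l v w" and h: "h \<in> V" "v \<noteq> h" "nb E V w = {v, h}"
    using assms unfolding tail3_def by auto
  show "w \<noteq> h" using nb_irr[of w] h by auto
  show "l \<noteq> h"
  proof
    assume "l = h"
    then have "w \<in> nb E V l" using nb_sym[of w h] h stubD[OF s] by blast
    then show False using stubD[OF s] by auto
  qed
qed

text \<open>If \<open>h\<close> were chosen, then after deleting the leaf \<open>l\<close> the
  single vertex \<open>v\<close> could replace \<open>l\<close> and \<open>w\<close>, because
  \<open>w\<close> sees \<open>v\<close> and \<open>h\<close>.\<close>

lemma tail3_head_notin: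
  assumes t: "tail3 l v w h" and S: "minset E V S"
  shows "h \<notin> S"
proof
  assume h: "h \<in> S"
  note t' = tail3D[OF t] and S' = minsetD[OF S]
  note st = stubD[OF t'(1)]
  have sm: "l \<in> S" "v \<notin> S" "w \<in> S" using stub_minset[OF t'(1) S] by auto
  define Q where "Q = insert v (S - {l, w})"
  have hQ: "h \<in> Q" "v \<in> Q" using h t' unfolding Q_def by auto
  have "dom2 E Q (V - {l})"
  proof (rule dom2_nbI)
    fix u assume u: "u \<in> V - {l}" "u \<notin> Q"
    show "\<exists>a\<in>Q. \<exists>b\<in>Q. a \<noteq> b \<and> a \<in> nb E V u \<and> b \<in> nb E V u"
    proof (cases "u = w")
      case True
      then have "v \<in> nb E V u" "h \<in> nb E V u" using t'(4) by simp_all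
      then show ?thesis using hQ t'(3) by blast
    next
      case False
      then have uS: "u \<in> V" "u \<notin> S" "u \<noteq> v" "u \<noteq> h" using u hQ unfolding Q_def by auto
      obtain a b where ab: "a \<in> S" "b \<in> S" "a \<noteq> b" "a \<in> nb E V u" "b \<in> nb E V u"
        using dom2_nb[OF S'(2) uS(1,2) S'(1)] by blast
      have "l \<notin> nb E V u" "w \<notin> nb E V u"
        using nb_sym[OF uS(1), of l] nb_sym[OF uS(1), of w] st(5) t'(4) uS by auto
      then have "a \<in> Q" "b \<in> Q" using ab unfolding Q_def by auto
      then show ?thesis using ab by blast
    qed
  qed
  then have "gam2 E V \<le> card Q"
    using S'(1) st unfolding Q_def by (intro stable2_gam2_le[OF stab st(1)]) auto
  also have "card Q < card S"
  proof -
    note finS = minset_finite[OF S]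
    have "card (S - {l, w}) = card S - 2" using sm st finS by (simp add: card_Diff_subset)
    moreover have "2 \<le> card S" using card_mono[OF finS, of "{l, w}"] sm st by simp
    moreover have "card Q \<le> Suc (card (S - {l, w}))"
      unfolding Q_def using finS by (simp add: card_insert_if)
    ultimately show ?thesis by linarith
  qed
  finally show False using S'(3) by simp
qed

lemma tail3_not_stub: "tail3 l v w h \<Longrightarrow> stub l' v' h \<Longrightarrow> False"
  using tail3_head_notin stub_minset(3) minset_exists by blast

text \<open>Deleting \<open>w\<close> isolates the edge \<open>l v\<close>, so both ends are chosen;
  shifting \<open>v\<close> to \<open>w\<close> gives a minimum set \<open>Q\<close> of the whole
  graph. Thus \<open>h\<close> is unchosen already before the shift and has two chosen neighbours
  different from \<open>w\<close>. Together with \<open>w\<close> these are three neighbours of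
  \<open>h\<close> in \<open>Q\<close>, too many for a vertex with a leaf.\<close>

lemma tail3_head:
  assumes t: "tail3 l v w h"
  shows "\<exists>a b. a \<in> nb E V h \<and> b \<in> nb E V h \<and> a \<noteq> b \<and> a \<noteq> w \<and> b \<noteq> w"
    and "\<And>q. q \<in> V \<Longrightarrow> nb E V q = {h} \<Longrightarrow> False"
proof -
  note t' = tail3D[OF t]
  note st = stubD[OF t'(1)]
  obtain S where S: "S \<subseteq> V - {w}" "dom2 E S (V - {w})" "card S = gam2 E V"
    using stable2_minset_del[OF stab st(3)] by blast
  have SV: "S \<subseteq> V" and finS: "finite S" using S(1) fin finite_subset by blast+
  have l: "l \<in> S" using in_minset[OF S(2) _ SV, of l v] st by blast
  have v: "v \<in> S" using in_minset[OF S(2) _ SV, of v l] st S(1) by blast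
  define Q where "Q = insert w (S - {v})"
  have lQ: "l \<in> Q" "w \<in> Q" using l st unfolding Q_def by auto
  have "dom2 E Q V"
  proof (rule dom2_nbI)
    fix u assume u: "u \<in> V" "u \<notin> Q"
    show "\<exists>a\<in>Q. \<exists>b\<in>Q. a \<noteq> b \<and> a \<in> nb E V u \<and> b \<in> nb E V u"
    proof (cases "u = v")
      case True
      then have "l \<in> nb E V u" "w \<in> nb E V u" using st(6) by simp_all
      then show ?thesis using lQ st(4) by blast
    next
      case False
      then have uS: "u \<in> V - {w}" "u \<notin> S" using u unfolding Q_def by auto
      obtain a b where ab: "a \<in> S" "b \<in> S" "a \<noteq> b" "a \<in> nb E V u" "b \<in> nb E V u"
        using dom2_nb[OF S(2) uS SV] by blast
      have "v \<notin> nb E V u" using nb_sym[OF u(1), of v] st(6) uS l by auto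
      then have "a \<in> Q" "b \<in> Q" using ab unfolding Q_def by auto
      then show ?thesis using ab by blast
    qed
  qed
  moreover have "card Q = card S"
    using card_Suc_Diff1[OF finS v] S(1) finS unfolding Q_def by (subst card_insert_disjoint) auto
  ultimately have Q: "minset E V Q"
    using SV st S(3) unfolding minset_def Q_def by auto
  have h: "h \<notin> Q" by (rule tail3_head_notin[OF t Q])
  then have hS: "h \<notin> S" "h \<in> V - {w}" using t' unfolding Q_def by auto
  obtain a b where ab: "a \<in> S" "b \<in> S" "a \<noteq> b" "a \<in> nb E V h" "b \<in> nb E V h"
    using dom2_nb[OF S(2) hS(2,1) SV] by blast
  have vh: "v \<notin> nb E V h" using nb_sym[OF t'(2), of v] st t' by auto
  have w: "a \<noteq> w" "b \<noteq> w" using ab S(1) by auto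
  then show "\<exists>a b. a \<in> nb E V h \<and> b \<in> nb E V h \<and> a \<noteq> b \<and> a \<noteq> w \<and> b \<noteq> w"
    using ab by blast
  fix q assume q: "q \<in> V" "nb E V q = {h}"
  have "q \<noteq> w" using q(2) t' by auto
  moreover have "w \<in> nb E V h" using nb_sym[OF st(3)] t' by auto
  moreover have "a \<in> Q" "b \<in> Q" using ab vh unfolding Q_def by auto
  ultimately show False
    using leaf_support(2)[OF q Q, of a w] leaf_support(2)[OF q Q, of b w] ab w lQ by blast
qed

end

text \<open>A bottom-up substitute for a longest path: leaves are removed three times, and a vertex with at
  most one neighbour in what remains plays the role of the fourth vertex from the end.\<close>

definition core :: "('a \<Rightarrow> 'a \<Rightarrow> bool) \<Rightarrow> 'a set \<Rightarrow> 'a set" where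
  "core E U = {u \<in> U. \<exists>a\<in>U. \<exists>b\<in>U. a \<noteq> b \<and> E u a \<and> E u b}"

lemma core_subset: "core E U \<subseteq> U"
  unfolding core_def by blast

section \<open>Three rounds of leaf removal in a stable forest\<close>

locale stable_forest = stable_graph +
  assumes acyc: "acyclic_on E V" and nonempty: "V \<noteq> {}"
begin

definition "V1 = core E V"
definition "V2 = core E V1"
definition "V3 = core E V2"

lemma V_chain: "V1 \<subseteq> V" "V2 \<subseteq> V1" "V3 \<subseteq> V2"
  unfolding V1_def V2_def V3_def by (rule core_subset)+

lemma in_core: "u \<in> core E U \<longleftrightarrow> u \<in> U \<and> (\<exists>a\<in>U. \<exists>b\<in>U. a \<noteq> b \<and> E u a \<and> E u b)"
  unfolding core_def by blast

lemma V1_nb: "u \<in> V1 \<longleftrightarrow> u \<in> V \<and> (\<exists>a b. a \<noteq> b \<and> a \<in> nb E V u \<and> b \<in> nb E V u)"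
  unfolding V1_def in_core nb_def by blast

lemma leafD: "u \<in> V \<Longrightarrow> u \<notin> V1 \<Longrightarrow> \<exists>s. nb E V u = {s}"
  using nb_nonempty[of u] unfolding V1_nb by blast

lemma not_leaf: "u \<in> V1 \<Longrightarrow> nb E V u \<noteq> {s}"
  unfolding V1_nb by auto

text \<open>\<open>x\<close> stands for the only further neighbour that \<open>y\<close> may have;
  if there is none, \<open>x\<close> is an arbitrary filler.\<close>

definition twoleaf :: "'a \<Rightarrow> 'a \<Rightarrow> 'a \<Rightarrow> 'a \<Rightarrow> bool" where
  "twoleaf l y m x \<longleftrightarrow> l \<in> V \<and> y \<in> V \<and> m \<in> V \<and> l \<noteq> m \<and> nb E V l = {y} \<and> nb E V m = {y} \<and>
     {l, m} \<subseteq> nb E V y \<and> nb E V y \<subseteq> {l, m, x}"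

text \<open>All neighbours of \<open>u\<close> except at most one in \<open>V1\<close> are leaves.
  Three leaves contradict stability and two would form a \<open>twoleaf\<close>, so \<open>u\<close>
  has one leaf and one neighbour in \<open>V1\<close>.\<close>

lemma layer1:
  assumes no: "\<And>l y m x. \<not> twoleaf l y m x" and u: "u \<in> V1" "u \<notin> V2"
  shows "\<exists>l w. stub l u w \<and> w \<in> V1"
proof -
  have uV: "u \<in> V" using u V_chain by blast
  have one: "a = b" if "a \<in> nb E V u" "b \<in> nb E V u" "a \<in> V1" "b \<in> V1" for a b
    using that u unfolding V2_def in_core nb_def by blast
  have leaf: "a \<in> V \<and> nb E V a = {u}" if "a \<in> nb E V u" "a \<notin> V1" for a
    using leafD[of a] nb_sym[OF uV that(1)] nb_in(1)[OF that(1)] that(2) by auto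
  obtain a b where ab: "a \<noteq> b" "a \<in> nb E V u" "b \<in> nb E V u" using u(1) V1_nb by blast
  then obtain l where l: "l \<in> nb E V u" "l \<notin> V1" using one by blast
  note ll = leaf[OF l]
  have "m = l" if m: "m \<in> nb E V u" "m \<notin> V1" for m
  proof (rule ccontr)
    assume "m \<noteq> l"
    note mm = leaf[OF m]
    have two: "c = l \<or> c = m" if "c \<in> nb E V u" "c \<notin> V1" for c
      using not_three_leaves[of l m c u] ll mm leaf[OF that] \<open>m \<noteq> l\<close> by blast
    obtain x where "nb E V u \<subseteq> {l, m, x}"
    proof (cases "\<exists>x. x \<in> nb E V u \<and> x \<in> V1")
      case True
      then show thesis using that one two by blast
    next
      case False
      then show thesis using that[of l] two by blast
    qed
    then have "twoleaf l u m x" using ll mm l m uV \<open>m \<noteq> l\<close> unfolding twoleaf_def by blast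
    then show False using no by blast
  qed
  then obtain w where w: "w \<in> nb E V u" "w \<in> V1" using ab by blast
  have "nb E V u = {l, w}"
  proof
    show "nb E V u \<subseteq> {l, w}" using w one \<open>\<And>m. m \<in> nb E V u \<Longrightarrow> m \<notin> V1 \<Longrightarrow> m = l\<close> by blast
  qed (use l w in blast)
  moreover have "l \<noteq> w" using l w by blast
  moreover have "w \<in> V" using w V_chain by blast
  ultimately have "stub l u w" using ll uV unfolding stub_def by blast
  then show ?thesis using w by blast
qed

lemma stub_V2:
  assumes no: "\<And>l y m x. \<not> twoleaf l y m x" and st: "stub l u w" and w: "w \<in> V1"
  shows "w \<in> V2"
proof (rule ccontr)
  assume "w \<notin> V2"
  then obtain l' w' where "stub l' w w'" using layer1[OF no w] by blast
  then show False using stub_not_leaf[OF st, of l'] stubD(1,5) by blast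
qed

lemma stub_notin: "stub l v w \<Longrightarrow> l \<notin> V1 \<and> v \<notin> V2"
proof
  assume st: "stub l v w"
  note s = stubD[OF st]
  show l: "l \<notin> V1" using not_leaf s(5) by blast
  show "v \<notin> V2"
  proof
    assume "v \<in> V2"
    then obtain a b where ab: "a \<in> V1" "b \<in> V1" "a \<noteq> b" "E v a" "E v b"
      unfolding V2_def in_core by blast
    then have "a \<in> nb E V v" "b \<in> nb E V v" using V_chain nb_in(3) by blast+
    then show False using ab l s(6) by auto
  qed
qed

lemma stub_at:
  assumes no: "\<And>l y m x. \<not> twoleaf l y m x" and v: "v \<in> V1" "v \<notin> V2" and u: "u \<in> V1" "v \<in> nb E V u"
  shows "\<exists>l. stub l v u"
proof -
  obtain l w where st: "stub l v w" using layer1[OF no v] by blast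
  have "u \<in> nb E V v" using nb_sym u V_chain by blast
  then have "u = l \<or> u = w" using stubD(6)[OF st] by auto
  then show ?thesis using st stub_notin[OF st] u by blast
qed

text \<open>\<open>u\<close> has two neighbours in \<open>V1\<close> but at most one in
  \<open>V2\<close>, so some stub hangs off \<open>u\<close>. By \<open>stub_unique\<close> and
  \<open>stub_not_leaf\<close> every other neighbour lies in \<open>V2\<close>, which leaves exactly
  one.\<close>

lemma layer2:
  assumes no: "\<And>l y m x. \<not> twoleaf l y m x" and u: "u \<in> V2" "u \<notin> V3"
  shows "\<exists>l v h. tail3 l v u h \<and> h \<in> V2"
proof -
  have u1: "u \<in> V1" and uV: "u \<in> V" using u V_chain by blast+
  have one: "a = b" if "a \<in> nb E V u" "b \<in> nb E V u" "a \<in> V2" "b \<in> V2" for a b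
    using that u unfolding V3_def in_core nb_def by blast
  obtain a b where ab: "a \<in> V1" "b \<in> V1" "a \<noteq> b" "E u a" "E u b"
    using u(1) unfolding V2_def in_core by blast
  then have abn: "a \<in> nb E V u" "b \<in> nb E V u" using V_chain nb_in(3) by blast+
  obtain v where v: "v \<in> nb E V u" "v \<in> V1" "v \<notin> V2" using one[OF abn] ab abn by blast
  then obtain l where st: "stub l v u" using stub_at[OF no] u1 by blast
  have V2: "c \<in> V2" if c: "c \<in> nb E V u" "c \<noteq> v" for c
  proof (rule ccontr)
    assume c2: "c \<notin> V2"
    have cV: "c \<in> V" and uc: "u \<in> nb E V c" using c nb_in(1) nb_sym[OF uV] by blast+
    show False
    proof (cases "c \<in> V1")
      case True
      then obtain l' where "stub l' c u" using stub_at[OF no True c2 u1 c(1)] by blast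
      then show False using stub_unique[OF st] c(2) by blast
    next
      case False
      then have "nb E V c = {u}" using leafD[OF cV] uc by auto
      then show False using stub_not_leaf[OF st cV] by blast
    qed
  qed
  obtain h where h: "h \<in> nb E V u" "h \<noteq> v" using abn ab(3) by blast
  have "nb E V u = {v, h}" using V2 one h v(1) by blast
  then have "tail3 l v u h" using st h nb_in(1) unfolding tail3_def by blast
  then show ?thesis using V2 h by blast
qed

text \<open>If \<open>V3\<close> were empty, a vertex of \<open>V2\<close> would end a tail whose
  head \<open>h\<close> also lies in \<open>V2\<close>, so that \<open>layer2\<close> would apply to
  \<open>h\<close> and give it degree two; but \<open>tail3_head\<close> gives heads degree at least
  three. \<open>V1\<close> itself is nonempty, since otherwise some component is a single edge,
  whose ends are both forced in as leaves and forced out as neighbours of leaves.\<close>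

lemma V3_nonempty:
  assumes no: "\<And>l y m x. \<not> twoleaf l y m x"
  shows "V3 \<noteq> {}"
proof
  assume e: "V3 = {}"
  obtain u0 where u0: "u0 \<in> V" using nonempty by blast
  have "\<exists>u. u \<in> V1"
  proof (rule ccontr)
    assume n: "\<not> (\<exists>u. u \<in> V1)"
    then obtain s where s: "nb E V u0 = {s}" using leafD u0 by blast
    then have sV: "s \<in> V" using nb_in(1)[of s u0] by blast
    obtain t where "nb E V s = {t}" using leafD sV n by blast
    then have t: "nb E V s = {u0}" using nb_sym[OF u0, of s] s by auto
    obtain S where S: "minset E V S" using minset_exists by blast
    have "s \<in> S" using leaf_in[OF sV t] minsetD[OF S] by blast
    then show False using leaf_support(1)[OF u0 s S] by blast
  qed
  then obtain u where "u \<in> V2" using layer1[OF no] stub_V2[OF no] by blast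
  then obtain l v h where t: "tail3 l v u h" "h \<in> V2" using layer2[OF no] e by blast
  then obtain l' v' h' where "tail3 l' v' h h'" using layer2[OF no] e by blast
  then have h: "nb E V h = {v', h'}" unfolding tail3_def by blast
  have "u \<in> V" "h \<in> nb E V u" using t(1) unfolding tail3_def stub_def by blast+
  then have "u \<in> nb E V h" using nb_sym by blast
  then show False using tail3_head(1)[OF t(1)] h by auto
qed

text \<open>\<open>h\<close> is a vertex with at most one neighbour in \<open>V3\<close>. Having two
  in \<open>V2\<close>, it is the head of a tail; this excludes leaves and stubs at
  \<open>h\<close>, so all neighbours outside \<open>V3\<close> are tails, and it gives degree
  three.\<close>

lemma layer3:
  assumes no: "\<And>l y m x. \<not> twoleaf l y m x"
  shows "\<exists>h x. h \<in> V \<and> 3 \<le> card (nb E V h) \<and>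
    (\<forall>c\<in>nb E V h. c = x \<or> (\<exists>l v. tail3 l v c h))"
proof -
  have "V3 \<subseteq> V" using V_chain by blast
  then have "\<exists>u\<in>V3. \<forall>a\<in>V3. \<forall>b\<in>V3. E u a \<longrightarrow> E u b \<longrightarrow> a = b"
    using spec[OF acyc[unfolded acyclic_on_def], of V3] V3_nonempty[OF no] by simp
  then obtain h where h: "h \<in> V3"
    and one: "\<And>a b. a \<in> V3 \<Longrightarrow> b \<in> V3 \<Longrightarrow> E h a \<Longrightarrow> E h b \<Longrightarrow> a = b"
    by blast
  have hV: "h \<in> V" "h \<in> V1" "h \<in> V2" using h V_chain by blast+
  have tail: "\<exists>l v. tail3 l v c h" if c: "c \<in> nb E V h" "c \<in> V2" "c \<notin> V3" for c
  proof -
    obtain l v h' where t: "tail3 l v c h'" using layer2[OF no c(2,3)] by blast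
    have "h \<in> nb E V c" using nb_sym[OF hV(1) c(1)] .
    then have "h = v \<or> h = h'" using t unfolding tail3_def by auto
    then show ?thesis using t stub_notin[OF tail3D(1)[OF t]] hV by blast
  qed
  obtain a b where ab: "a \<in> V2" "b \<in> V2" "a \<noteq> b" "E h a" "E h b"
    using h unfolding V3_def in_core by blast
  then have abn: "a \<in> nb E V h" "b \<in> nb E V h" using V_chain nb_in(3) by blast+
  have "a \<notin> V3 \<or> b \<notin> V3" using one ab by blast
  then obtain w l v where t: "tail3 l v w h" "w \<in> nb E V h" using tail ab abn by blast
  have tail': "\<exists>l v. tail3 l v c h" if c: "c \<in> nb E V h" "c \<notin> V3" for c
  proof (cases "c \<in> V2")
    case True
    then show ?thesis using tail c by blast
  next
    case c2: False
    have cV: "c \<in> V" "h \<in> nb E V c" using c nb_in(1) nb_sym[OF hV(1)] by blast+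
    show ?thesis
    proof (cases "c \<in> V1")
      case True
      then show ?thesis using stub_at[OF no True c2 hV(2) c(1)] tail3_not_stub[OF t(1)] by blast
    next
      case False
      then have "nb E V c = {h}" using leafD[OF cV(1)] cV(2) by auto
      then show ?thesis using tail3_head(2)[OF t(1) cV(1)] by blast
    qed
  qed
  obtain x where x: "\<And>c. c \<in> nb E V h \<Longrightarrow> c \<in> V3 \<Longrightarrow> c = x"
    using one nb_in(2) by metis
  obtain p q where pq: "p \<in> nb E V h" "q \<in> nb E V h" "p \<noteq> q" "p \<noteq> w" "q \<noteq> w"
    using tail3_head(1)[OF t(1)] by blast
  have "finite (nb E V h)" using fin unfolding nb_def by simp
  then have "card {p, q, w} \<le> card (nb E V h)" using pq t(2) by (intro card_mono) auto
  then have "3 \<le> card (nb E V h)" using pq by simp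
  then show ?thesis using hV(1) x tail' by blast
qed

lemma twoleaf_pendant:
  assumes "twoleaf l y m x"
  shows "pendant_P3 E (V - {l, y, m}) x y l m"
proof -
  have t: "l \<in> V" "y \<in> V" "m \<in> V" "l \<noteq> m" "nb E V l = {y}" "nb E V m = {y}"
    "l \<in> nb E V y" "m \<in> nb E V y" "nb E V y \<subseteq> {l, m, x}"
    using assms unfolding twoleaf_def by auto
  have ly: "l \<noteq> y" "m \<noteq> y" using t nb_irr by auto
  show ?thesis
  proof
    show "\<forall>u\<in>V - {l, y, m}. \<forall>p\<in>{l, y, m}. E u p \<longrightarrow> u = x \<and> p = y"
    proof (intro ballI impI)
      fix u p assume up: "u \<in> V - {l, y, m}" "p \<in> {l, y, m}" "E u p"
      have "u \<in> nb E V p" using up sympD[OF sym up(3)] unfolding nb_def by blast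
      then show "u = x \<and> p = y" using up t ly by auto
    qed
    fix p assume "p \<in> {l, y, m}" "E l p \<or> E m p"
    then have "p \<in> nb E V l \<or> p \<in> nb E V m" using t nb_in(3) by blast
    then show "p = y" using t by auto
  qed (use fin sym ly t nb_in(2) in auto)
qed

text \<open>The legs are indexed by their own first vertices, hence the identity in the place of
  \<open>a\<close>. Disjointness and injectivity are read off the prescribed neighbourhoods.\<close>

lemma tails_pendant:
  assumes h: "h \<in> V" and I: "I \<subseteq> nb E V h" "2 \<le> card I"
    and x: "nb E V h - I \<subseteq> {x}"
    and t: "\<And>i. i \<in> I \<Longrightarrow> tail3 (c i) (b i) i h"
    and P: "P = insert h ((\<lambda>i. i) ` I \<union> b ` I \<union> c ` I)"
  shows "pendant_spider E (V - P) x h I (\<lambda>i. i) b c P" and "P \<subseteq> V"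
    and "nb E V h \<inter> P = I"
proof -
  have t': "c i \<in> V" "b i \<in> V" "i \<in> V" "c i \<noteq> i" "nb E V (c i) = {b i}" "nb E V (b i) = {c i, i}"
    "c i \<noteq> b i" "b i \<noteq> i" "b i \<noteq> h" "nb E V i = {b i, h}" "i \<noteq> h" "c i \<noteq> h" if "i \<in> I" for i
    using tail3D[OF t[OF that]] stubD[OF tail3D(1)[OF t[OF that]]] by auto
  show PV: "P \<subseteq> V" using P t' h by auto
  have ib: "i \<noteq> b j" if "i \<in> I" "j \<in> I" for i j
  proof
    assume "i = b j"
    then have "h \<in> {c j, j}" using t'(6)[OF that(2)] t'(10)[OF that(1)] by blast
    then show False using t'(11,12)[OF that(2)] by blast
  qed
  have ic: "i \<noteq> c j" if "i \<in> I" "j \<in> I" for i j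
    using t'(5)[OF that(2)] t'(9,10)[OF that(1)] by auto
  have bc: "b i \<noteq> c j" if "i \<in> I" "j \<in> I" for i j
    using t'(5)[OF that(2)] t'(4,6)[OF that(1)] by auto
  have injb: "inj_on b I"
  proof (rule inj_onI)
    fix i j assume ij: "i \<in> I" "j \<in> I" "b i = b j"
    then have "i \<in> {c j, j}" using t'(6)[OF ij(1)] t'(6)[OF ij(2)] by auto
    then show "i = j" using ic ij by blast
  qed
  have injc: "inj_on c I"
  proof (rule inj_onI)
    fix i j assume ij: "i \<in> I" "j \<in> I" "c i = c j"
    then have "b i = b j" using t'(5)[OF ij(1)] t'(5)[OF ij(2)] by auto
    then show "i = j" using injb ij unfolding inj_on_def by blast
  qed
  have "h \<notin> nb E V (b i)" "h \<notin> nb E V (c i)" if "i \<in> I" for i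
    using t'[OF that] by auto
  then have bch: "b i \<notin> nb E V h" "c i \<notin> nb E V h" if "i \<in> I" for i
    using nb_sym[OF h] that by blast+
  then show nbP: "nb E V h \<inter> P = I" using P I(1) nb_irr[of h] by auto
  have finI: "finite I" using I(1) fin by (rule_tac finite_subset[of I V]) (auto simp: nb_def)
  have nbr: "v \<in> nb E V u" if "E u v" "v \<in> P" for u v using that PV nb_in(3) by blast
  show "pendant_spider E (V - P) x h I (\<lambda>i. i) b c P"
  proof
    show "\<forall>u\<in>V - P. \<forall>p\<in>P. E u p \<longrightarrow> u = x \<and> p = h"
    proof (intro ballI impI)
      fix u p assume up: "u \<in> V - P" "p \<in> P" "E u p"
      have u: "u \<in> nb E V p" using up sympD[OF sym up(3)] unfolding nb_def by blast
      from up(2) consider "p = h" | i where "i \<in> I" "p = i \<or> p = b i \<or> p = c i"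
        using P by auto
      then show "u = x \<and> p = h"
      proof cases
        case 1
        then show ?thesis using u x up(1) nbP I(1) by blast
      next
        case 2
        then have "u \<in> P" using u t'[OF 2(1)] P by auto
        then show ?thesis using up(1) by blast
      qed
    qed
    fix i assume i: "i \<in> I"
    show "E h i \<and> E i (b i) \<and> E (b i) (c i)"
      using t'[OF i] I(1) i nb_in(2)[of i h] nb_in(2)[of "b i" i] nb_in(2)[of "c i" "b i"] by blast
    show "i \<noteq> h \<and> b i \<noteq> h \<and> c i \<noteq> h" using t'[OF i] by blast
    fix p assume p: "p \<in> P"
    show "E (c i) p \<Longrightarrow> p = b i" using nbr[of "c i" p] p t'(5)[OF i] by blast
    show "E (b i) p \<Longrightarrow> p = i \<or> p = c i" using nbr[of "b i" p] p t'(6)[OF i] by blast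
    show "E i p \<Longrightarrow> p = h \<or> p = b i" using nbr[of i p] p t'(10)[OF i] by blast
  next
    fix i j assume ij: "i \<in> I" "j \<in> I"
    show "i \<noteq> b j \<and> i \<noteq> c j \<and> b i \<noteq> c j" using ib[OF ij] ic[OF ij] bc[OF ij] by blast
  next
    fix p assume "p \<in> P" "E h p"
    then show "p \<in> (\<lambda>i. i) ` I" using nbr[of h p] nbP by blast
  next
    show "finite (V - P)" using fin by blast
    show "inj_on (\<lambda>i. i) I" by (rule inj_on_id2)
    show "(V - P) \<inter> P = {}" by blast
  qed (fact finI sym P injb injc I(2))+
qed

text \<open>The last condition of each case separates a genuine attaching vertex \<open>x\<close>
  from a filler. In the latter event no edge leaves the piece, so in a connected graph the piece is
  everything.\<close>

theorem decompose:
  obtains (P3) x y l m where "pendant_P3 E (V - {l, y, m}) x y l m" "{l, y, m} \<subseteq> V"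
      "x \<in> V - {l, y, m} \<and> E x y \<or> nb E V y \<subseteq> {l, m}"
  | (spider) x h I b c P where "pendant_spider E (V - P) x h I (\<lambda>i::'a. i) b c P" "P \<subseteq> V"
      "x \<in> V - P \<and> E x h \<or> nb E V h \<subseteq> P \<and> 3 \<le> card I"
proof (cases "\<exists>l y m x. twoleaf l y m x")
  case True
  then obtain l y m x where t: "twoleaf l y m x" by blast
  have "x \<in> V - {l, y, m} \<and> E x y \<or> nb E V y \<subseteq> {l, m}"
  proof (cases "x \<in> nb E V y - {l, m}")
    case True
    then have "x \<in> V" "E x y" "x \<noteq> y" using nb_in(1,2) sympD[OF sym] nb_irr by blast+
    then show ?thesis using True by blast
  next
    case False
    then show ?thesis using t unfolding twoleaf_def by blast
  qed
  moreover have "{l, y, m} \<subseteq> V" using t unfolding twoleaf_def by blast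
  ultimately show thesis using P3 twoleaf_pendant[OF t] by blast
next
  case False
  then obtain h x where h: "h \<in> V" "3 \<le> card (nb E V h)"
    and hx: "\<And>c. c \<in> nb E V h \<Longrightarrow> c = x \<or> (\<exists>l v. tail3 l v c h)"
    using layer3 by blast
  define I where "I = {i \<in> nb E V h. \<exists>l v. tail3 l v i h}"
  have "\<forall>i\<in>I. \<exists>b c. tail3 c b i h" unfolding I_def by blast
  then obtain b c where t: "\<And>i. i \<in> I \<Longrightarrow> tail3 (c i) (b i) i h" by metis
  have I: "I \<subseteq> nb E V h" "nb E V h - I \<subseteq> {x}" using hx unfolding I_def by blast+
  have finN: "finite (nb E V h)" using fin unfolding nb_def by simp
  have cN: "card (nb E V h) = card I + card (nb E V h - I)"
    using card_Diff_subset[OF finite_subset[OF I(1) finN] I(1)] card_mono[OF finN I(1)] by simp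
  have c1: "card (nb E V h - I) \<le> 1" using card_mono[OF _ I(2)] by simp
  \<comment> \<open>At least three neighbours, of which at most one is not a leg. If none is
    missing, there are three legs, so a two-legged spider never stands alone.\<close>
  then have I2: "2 \<le> card I" using cN h(2) by simp
  define P where "P = insert h ((\<lambda>i. i) ` I \<union> b ` I \<union> c ` I)"
  note tp = tails_pendant[OF h(1) I(1) I2 I(2) t P_def]
  have "x \<in> V - P \<and> E x h \<or> nb E V h \<subseteq> P \<and> 3 \<le> card I"
  proof (cases "x \<in> nb E V h - I")
    case True
    then have "x \<in> V" "E x h" using nb_in(1,2) sympD[OF sym] by blast+
    moreover have "x \<notin> P" using True tp(3) by blast
    ultimately show ?thesis by blast
  next
    case False
    then have "nb E V h = I" using I by blast
    then show ?thesis using tp(3) h(2) by blast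
  qed
  then show thesis using spider[OF tp(1,2)] by blast
qed

end

section \<open>Trees\<close>

abbreviation adj :: "'a pair_pre_digraph \<Rightarrow> 'a \<Rightarrow> 'a \<Rightarrow> bool" where
  "adj T u v \<equiv> (u, v) \<in> parcs T"

text \<open>Connectedness through closed sets avoids walks: it is applied by exhibiting a closed set
  and survives the removal of a piece by enlarging one.\<close>

definition edge_connected :: "('a \<Rightarrow> 'a \<Rightarrow> bool) \<Rightarrow> 'a set \<Rightarrow> bool" where
  "edge_connected E V \<longleftrightarrow> V \<noteq> {} \<and>
     (\<forall>U\<subseteq>V. U \<noteq> {} \<longrightarrow> (\<forall>u\<in>U. \<forall>v\<in>V. E u v \<longrightarrow> v \<in> U) \<longrightarrow> U = V)"

lemma pair_graph_altdef:
  "pair_graph T \<longleftrightarrow> finite (pverts T) \<and> parcs T \<subseteq> pverts T \<times> pverts T \<and>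
     symp (adj T) \<and> irreflp (adj T)"
proof
  assume "pair_graph T"
  then interpret pair_graph T .
  have "symp (adj T)"
    using pair_sym_arcs unfolding symmetric_def by (auto simp: sym_def symp_def)
  moreover have "irreflp (adj T)" using pair_no_loops unfolding irreflp_def by fastforce
  ultimately show "finite (pverts T) \<and> parcs T \<subseteq> pverts T \<times> pverts T \<and> symp (adj T) \<and> irreflp (adj T)"
    using pair_finite_verts in_arcsD1 in_arcsD2 by auto
next
  assume *: "finite (pverts T) \<and> parcs T \<subseteq> pverts T \<times> pverts T \<and> symp (adj T) \<and> irreflp (adj T)"
  show "pair_graph T"
  proof
    show "finite (parcs T)" using * finite_subset by blast
    show "symmetric (with_proj T)"
      using * unfolding symmetric_def by (auto simp: sym_def symp_def)
    show "fst e \<noteq> snd e" if "e \<in> parcs T" for e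
      using * that unfolding irreflp_def by (cases e) auto
  qed (use * in auto)
qed

lemma edge_connected_iff:
  assumes "pair_graph T"
  shows "connected (with_proj T) \<longleftrightarrow> edge_connected (adj T) (pverts T)"
proof -
  interpret pair_graph T by fact
  have sc: "(parcs T)\<^sup>s = parcs T"
    using pair_sym_arcs unfolding symmetric_def symcl_def by (auto simp: sym_def)
  have c: "connected (with_proj T) \<longleftrightarrow>
      pverts T \<noteq> {} \<and> (\<forall>u\<in>pverts T. \<forall>v\<in>pverts T. (u, v) \<in> rtrancl_on (pverts T) (parcs T))"
    unfolding connected_conv by (simp add: sc)
  show ?thesis
  proof
    assume con: "connected (with_proj T)"
    have "U = pverts T" if U: "U \<subseteq> pverts T" "U \<noteq> {}"
      and cl: "\<forall>u\<in>U. \<forall>v\<in>pverts T. adj T u v \<longrightarrow> v \<in> U" for U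
    proof -
      obtain u where u: "u \<in> U" using U by blast
      have "v \<in> U" if "(u, v) \<in> rtrancl_on (pverts T) (parcs T)" for v
        using that u
      proof (induction rule: rtrancl_on_induct)
        case (step b c)
        then show ?case using cl U by blast
      qed
      then show ?thesis using con u U unfolding c by blast
    qed
    then show "edge_connected (adj T) (pverts T)" using con unfolding c edge_connected_def by blast
  next
    assume e: "edge_connected (adj T) (pverts T)"
    have "(u, v) \<in> rtrancl_on (pverts T) (parcs T)" if u: "u \<in> pverts T" and v: "v \<in> pverts T" for u v
    proof -
      let ?U = "{v \<in> pverts T. (u, v) \<in> rtrancl_on (pverts T) (parcs T)}"
      have "u \<in> ?U" using u by simp
      moreover have "\<forall>w\<in>?U. \<forall>v\<in>pverts T. adj T w v \<longrightarrow> v \<in> ?U"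
        by (auto intro: rtrancl_on_into_rtrancl_on)
      ultimately have "?U = pverts T" using e unfolding edge_connected_def by (metis (lifting) empty_iff mem_Collect_eq subsetI)
      then show ?thesis using v by blast
    qed
    then show "connected (with_proj T)" using e unfolding c edge_connected_def by blast
  qed
qed

lemma vwalk_arcs_walk:
  "xs \<noteq> [] \<Longrightarrow> pcas (hd xs) (vwalk_arcs xs) (last xs) \<and> pawalk_verts (hd xs) (vwalk_arcs xs) = xs"
  by (induction xs rule: vwalk_arcs.induct) auto

text \<open>If every vertex of \<open>U\<close> had two neighbours in \<open>U\<close>, then all neighbours of the first vertex of a
  longest path in \<open>U\<close> would lie on the path, and the one furthest along would close a cycle.\<close>

lemma acyclic_on_tree:
  assumes pg: "pair_graph T" and nc: "\<not> (\<exists>p. pre_digraph.cycle (with_proj T) p \<and> 3 \<le> length p)"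
  shows "acyclic_on (adj T) (pverts T)"
proof (rule ccontr)
  assume "\<not> acyclic_on (adj T) (pverts T)"
  then obtain U where U: "U \<subseteq> pverts T" "U \<noteq> {}"
    and no: "\<not> (\<exists>u\<in>U. \<forall>a\<in>U. \<forall>b\<in>U. adj T u a \<longrightarrow> adj T u b \<longrightarrow> a = b)"
    unfolding acyclic_on_def by auto
  have two: "\<exists>a\<in>U. \<exists>b\<in>U. adj T u a \<and> adj T u b \<and> a \<noteq> b" if "u \<in> U" for u
    using no that by blast
  note T = pg[unfolded pair_graph_altdef]
  have finU: "finite U" using U T finite_subset by blast
  define path where "path xs \<longleftrightarrow> xs \<noteq> [] \<and> distinct xs \<and> set xs \<subseteq> U \<and> set (vwalk_arcs xs) \<subseteq> parcs T" for xs
  obtain u where "u \<in> U" using U by blast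
  then have "path [u]" unfolding path_def by simp
  moreover have "\<forall>xs. path xs \<longrightarrow> length xs < Suc (card U)"
  proof (intro allI impI)
    fix xs assume "path xs"
    then have "card (set xs) = length xs" "card (set xs) \<le> card U"
      using card_mono[OF finU] distinct_card[of xs] unfolding path_def by blast+
    then show "length xs < Suc (card U)" by simp
  qed
  ultimately obtain xs where xs: "path xs" and max: "\<And>ys. path ys \<Longrightarrow> length ys \<le> length xs"
    using ex_has_greatest_nat[of path "[u]" length "Suc (card U)"] by blast
  obtain v vs where v: "xs = v # vs" using xs unfolding path_def by (cases xs) auto
  have on: "a \<in> set xs" if "a \<in> U" "adj T v a" for a
  proof (rule ccontr)
    assume "a \<notin> set xs"
    moreover have "adj T a v" using T that sympD by metis
    ultimately have "path (a # xs)" using xs that v unfolding path_def by simp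
    then show False using max[of "a # xs"] by simp
  qed
  obtain a b where ab: "a \<in> set xs" "b \<in> set xs" "a \<noteq> b" "adj T v a" "adj T v b"
  proof -
    have "v \<in> U" using xs v unfolding path_def by simp
    then show thesis using two[of v] on that by blast
  qed
  obtain i j where ij: "i < length xs" "xs ! i = a" "j < length xs" "xs ! j = b"
    using ab by (metis in_set_conv_nth)
  have ne: "\<not> adj T v v" using T irreflpD by metis
  define c where "c = max i j"
  \<comment> \<open>Loops being excluded, neither neighbour of \<open>v\<close> is at position 0; as
    they differ, the later one is at position 2 or beyond, which gives the cycle its length of at
    least 3.\<close>
  have "i \<noteq> 0" "j \<noteq> 0" "i \<noteq> j" using ij ab ne v by (auto simp: nth_Cons' split: if_splits)
  then have c: "2 \<le> c" "c < length xs" "adj T v (xs ! c)"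
    using ij ab unfolding c_def by (auto simp: max_def)
  define d where "d = xs ! c"
  define ys where "ys = take c xs"
  have split: "xs = ys @ d # drop (Suc c) xs"
    using id_take_nth_drop[OF c(2)] unfolding d_def ys_def .
  have ys: "ys \<noteq> []" "hd ys = v" "length ys = c" using c v unfolding ys_def by (auto simp: hd_take)
  let ?p = "vwalk_arcs (ys @ [d, v])"
  have "set (vwalk_arcs (ys @ [d])) \<subseteq> set (vwalk_arcs xs)"
    using split set_vwalk_arcs_append1[of "ys @ [d]" "drop (Suc c) xs"] by simp
  moreover have p: "?p = vwalk_arcs (ys @ [d]) @ [(d, v)]"
    using vwalk_arcs_append[of "ys @ [d]" "[v]"] by simp
  moreover have "adj T d v" using c(3) T sympD unfolding d_def by metis
  ultimately have arcs: "set ?p \<subseteq> parcs T" using xs unfolding path_def by auto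
  have walk: "pcas v ?p v" "pawalk_verts v ?p = ys @ [d, v]"
    using vwalk_arcs_walk[of "ys @ [d, v]"] ys by auto
  have "distinct (ys @ [d])" using xs split unfolding path_def by (metis distinct_append append.assoc append_Cons append_Nil)
  \<comment> \<open>\<open>ys\<close> begins with \<open>v\<close>, so the tail of
    \<open>ys @ [d, v]\<close> is a rotation of \<open>ys @ [d]\<close>.\<close>
  then have "distinct (tl (pawalk_verts v ?p))"
    using ys walk(2) by (cases ys) auto
  moreover have "v \<in> pverts T" using xs v U unfolding path_def by auto
  ultimately have "pre_digraph.cycle (with_proj T) ?p"
    using arcs walk p unfolding pre_digraph.cycle_def pre_digraph.awalk_def
    by (auto simp: cas_with_proj_eq awalk_verts_with_proj_eq intro!: exI[of _ v])
  moreover have "length ?p = c + 1"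
    using vwalk_length_simp[of "ys @ [d, v]"] ys unfolding vwalk_length_def by simp
  then have "3 \<le> length ?p" using c(1) by simp
  ultimately show False using nc by blast
qed

lemma is_treeD:
  assumes "is_tree T"
  shows "finite (pverts T)" "parcs T \<subseteq> pverts T \<times> pverts T" "symp (adj T)" "irreflp (adj T)"
    "edge_connected (adj T) (pverts T)" "acyclic_on (adj T) (pverts T)"
  using assms pair_graph_altdef[of T] edge_connected_iff[of T] acyclic_on_tree[of T]
  unfolding is_tree_def by auto

definition induced :: "'a pair_pre_digraph \<Rightarrow> 'a set \<Rightarrow> 'a pair_pre_digraph" where
  "induced T U = \<lparr>pverts = U, parcs = parcs T \<inter> U \<times> U\<rparr>"

lemma induced_simps [simp]: "pverts (induced T U) = U" "parcs (induced T U) = parcs T \<inter> U \<times> U"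
  by (simp_all add: induced_def)

text \<open>Cycles of the remainder are cycles of \<open>T\<close>, so connectivity is the issue. A
  closed set of the remainder that contains \<open>x\<close> becomes closed in \<open>T\<close>
  after adding \<open>P\<close>; one that avoids \<open>x\<close> is already closed in
  \<open>T\<close>, which is impossible as it misses \<open>P\<close>.\<close>

lemma is_tree_remove_pendant:
  assumes T: "is_tree T" and V: "pverts T = R \<union> P" and disj: "R \<inter> P = {}" and ne: "R \<noteq> {}" "y \<in> P"
    and cut: "\<forall>u\<in>R. \<forall>p\<in>P. adj T u p \<longrightarrow> u = x \<and> p = y"
  shows "is_tree (induced T R)"
proof -
  note t = is_treeD[OF T]
  have pg: "pair_graph (induced T R)"
    unfolding pair_graph_altdef using t V by (auto simp: symp_def irreflp_def)
  have "U = R" if U: "U \<subseteq> R" "U \<noteq> {}" and cl: "\<forall>u\<in>U. \<forall>v\<in>R. adj T u v \<longrightarrow> v \<in> U" for U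
  proof (cases "x \<in> U")
    case True
    have "\<forall>u\<in>U \<union> P. \<forall>v\<in>pverts T. adj T u v \<longrightarrow> v \<in> U \<union> P"
    proof (intro ballI impI)
      fix u v assume uv: "u \<in> U \<union> P" "v \<in> pverts T" "adj T u v"
      show "v \<in> U \<union> P"
      proof (cases "u \<in> U")
        case False
        then have "v \<in> R \<Longrightarrow> v = x" using uv cut sympD[OF t(3) uv(3)] by blast
        then show ?thesis using uv(2) V True by blast
      qed (use uv cl V in blast)
    qed
    then have "U \<union> P = pverts T" using t(5) U V unfolding edge_connected_def by (metis Un_empty Un_mono order_refl)
    then show ?thesis using U V disj by blast
  next
    case False
    have "\<forall>u\<in>U. \<forall>v\<in>pverts T. adj T u v \<longrightarrow> v \<in> U" using cl cut False U V by blast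
    then have "U = pverts T" using t(5) U V unfolding edge_connected_def by (metis sup.coboundedI1)
    then show ?thesis using U V ne disj by blast
  qed
  then have "edge_connected (adj (induced T R)) R"
    using ne unfolding edge_connected_def by auto
  then have "connected (with_proj (induced T R))" using edge_connected_iff[OF pg] by simp
  moreover have "pre_digraph.cycle (with_proj T) p" if "pre_digraph.cycle (with_proj (induced T R)) p" for p
    using that V unfolding pre_digraph.cycle_def pre_digraph.awalk_def
    by (auto simp: cas_with_proj_eq awalk_verts_with_proj_eq)
  ultimately show ?thesis using pg T unfolding is_tree_def by blast
qed

text \<open>Deleting an inner vertex disconnects the tree; the translation to \<open>gam2\<close>
  survives because it asks for acyclicity, not for connectedness.\<close>

lemma gamma_ri2_stable_iff:
  assumes "is_tree T"
  shows "gamma_ri2_stable (with_proj T) \<longleftrightarrow> stable2 (adj T) (pverts T)"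
proof -
  note t = is_treeD[OF assms]
  have T: "gamma_ri2 (with_proj T) = gam2 (adj T) (pverts T)"
    using gamma_ri2_eq_gam2(4)[of "with_proj T" "adj T"] t by simp
  have "gamma_ri2 (pre_digraph.del_vert (with_proj T) v) = gam2 (adj T) (pverts T - {v})" for v
  proof -
    let ?H = "pre_digraph.del_vert (with_proj T) v"
    have v: "verts ?H = pverts T - {v}" by (simp add: pre_digraph.verts_del_vert)
    have a: "arcs ?H = {e \<in> parcs T. fst e \<noteq> v \<and> snd e \<noteq> v}" "tail ?H = fst" "head ?H = snd"
      by (simp_all add: pre_digraph.del_vert_def)
    have "(u, w) \<in> arcs_ends ?H \<longleftrightarrow> adj T u w" if "u \<in> verts ?H" "w \<in> verts ?H" for u w
      using that unfolding v arcs_ends_def arc_to_ends_def a by force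
    then show ?thesis
      using gamma_ri2_eq_gam2(4)[of ?H "adj T"] t(1,3,4) acyclic_on_subset[OF t(6)] unfolding v
      by blast
  qed
  then show ?thesis unfolding gamma_ri2_stable_def stable2_def by (simp add: T)
qed

lemma W0_iff:
  assumes "is_tree T"
  shows "W0 (with_proj T) = {v \<in> pverts T. \<forall>S. minset (adj T) (pverts T) S \<longrightarrow> v \<notin> S}"
  using W0_eq_minset[of "with_proj T" "adj T"] is_treeD[OF assms] by simp

lemma stable2_cong:
  assumes "\<And>u v. u \<in> V \<Longrightarrow> v \<in> V \<Longrightarrow> E u v \<longleftrightarrow> E' u v"
  shows "stable2 E V \<longleftrightarrow> stable2 E' V"
proof -
  have "gam2 E U = gam2 E' U" if "U \<subseteq> V" for U
    using gam2_cong[of U E E'] assms that by blast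
  then show ?thesis unfolding stable2_def by (metis Diff_subset order_refl)
qed

lemma minset_cong:
  assumes "\<And>u v. u \<in> V \<Longrightarrow> v \<in> V \<Longrightarrow> E u v \<longleftrightarrow> E' u v"
  shows "minset E V S \<longleftrightarrow> minset E' V S"
  unfolding minset_def
  using gam2_cong[of V E E', OF assms] dom2_cong[of V E E' S V, OF assms] by auto

section \<open>The tree family\<close>

lemma path_graph_simps:
  "pverts (path_graph xs) = set xs"
  "parcs (path_graph xs) = set (zip xs (tl xs)) \<union> (set (zip xs (tl xs)))\<inverse>"
  by (simp_all add: path_graph_def undirected_def)

lemma spider_graph_simps:
  "pverts (spider_graph k h p) = insert h {p i j | i j. i \<in> {1..k} \<and> j \<in> {1..3}}"
  "parcs (spider_graph k h p) = (\<Union>i\<in>{1..k}. {(h, p i 1), (p i 1, p i 2), (p i 2, p i 3)}) \<union>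
     (\<Union>i\<in>{1..k}. {(p i 1, h), (p i 2, p i 1), (p i 3, p i 2)})"
  unfolding spider_graph_def undirected_def by auto

lemma interval_1_3: "{1..3::nat} = {1, 2, 3}"
  by auto

lemma spider_verts:
  "pverts (spider_graph k h p) =
     insert h ((\<lambda>i. p i 1) ` {1..k} \<union> (\<lambda>i. p i 2) ` {1..k} \<union> (\<lambda>i. p i 3) ` {1..k})"
  unfolding spider_graph_simps interval_1_3 by blast

lemma spider_pendant:
  assumes S: "is_spider k h S" and sym: "symp E" and fin: "finite R" and disj: "R \<inter> pverts S = {}"
    and agree: "\<And>u v. u \<in> pverts S \<Longrightarrow> v \<in> pverts S \<Longrightarrow> E u v \<longleftrightarrow> adj S u v"
    and cut: "\<forall>u\<in>R. \<forall>p\<in>pverts S. E u p \<longrightarrow> u = x \<and> p = h"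
  obtains a b c where "pendant_spider E R x h {1..k} a b c (pverts S)"
proof -
  obtain p where k: "2 \<le> k" and inj: "inj_on (\<lambda>(i, j). p i j) ({1..k} \<times> {1..3::nat})"
    and ph: "\<And>i j. i \<in> {1..k} \<Longrightarrow> j \<in> {1..3} \<Longrightarrow> p i j \<noteq> h" and Sp: "S = spider_graph k h p"
    using S unfolding is_spider_def by blast
  have p: "p i j = p i' j' \<longleftrightarrow> i = i' \<and> j = j'"
    if "i \<in> {1..k}" "i' \<in> {1..k}" "j \<in> {1, 2, 3}" "j' \<in> {1, 2, 3}" for i i' j j'
    using inj_onD[OF inj, of "(i, j)" "(i', j')"] that by fastforce
  have h: "p i j \<noteq> h" "h \<noteq> p i j" if "i \<in> {1..k}" "j \<in> {1, 2, 3}" for i j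
    using ph[of i j] that by fastforce+
  note V = spider_verts[of k h p, folded Sp]
  have arcs: "adj S u v \<longleftrightarrow> (\<exists>i\<in>{1..k}. (u, v) \<in> {(h, p i 1), (p i 1, p i 2), (p i 2, p i 3),
      (p i 1, h), (p i 2, p i 1), (p i 3, p i 2)})" for u v
    unfolding Sp spider_graph_simps by blast
  have "pendant_spider E R x h {1..k} (\<lambda>i. p i 1) (\<lambda>i. p i 2) (\<lambda>i. p i 3) (pverts S)"
  proof
    show "inj_on (\<lambda>i. p i 1) {1..k}" "inj_on (\<lambda>i. p i 2) {1..k}" "inj_on (\<lambda>i. p i 3) {1..k}"
      using p by (auto intro!: inj_onI)
    fix i j assume ij: "i \<in> {1..k}" "j \<in> {1..k}"
    show "p i 1 \<noteq> p j 2 \<and> p i 1 \<noteq> p j 3 \<and> p i 2 \<noteq> p j 3" using p[OF ij] by simp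
  next
    fix i assume i: "i \<in> {1..k}"
    show "p i 1 \<noteq> h \<and> p i 2 \<noteq> h \<and> p i 3 \<noteq> h" using h[OF i] by simp
    have iS: "p i 1 \<in> pverts S" "p i 2 \<in> pverts S" "p i 3 \<in> pverts S" "h \<in> pverts S"
      using i V by auto
    have "adj S h (p i 1)" "adj S (p i 1) (p i 2)" "adj S (p i 2) (p i 3)"
      unfolding arcs using i by blast+
    then show "E h (p i 1) \<and> E (p i 1) (p i 2) \<and> E (p i 2) (p i 3)"
      using agree iS by blast
    fix q assume q: "q \<in> pverts S"
    have arc: "(\<exists>i'\<in>{1..k}. (u, q) \<in> {(h, p i' 1), (p i' 1, p i' 2), (p i' 2, p i' 3),
      (p i' 1, h), (p i' 2, p i' 1), (p i' 3, p i' 2)})" if "E u q" "u \<in> pverts S" for u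
      using agree[of u q] q arcs[of u q] that by blast
    show "q = p i 2" if e: "E (p i 3) q"
    proof -
      obtain i' where i': "i' \<in> {1..k}" "(p i 3, q) \<in> {(h, p i' 1), (p i' 1, p i' 2), (p i' 2, p i' 3),
          (p i' 1, h), (p i' 2, p i' 1), (p i' 3, p i' 2)}" using arc[OF e iS(3)] by blast
      then show ?thesis using p[OF i i'(1)] h[OF i] by auto
    qed
    show "q = p i 1 \<or> q = p i 3" if e: "E (p i 2) q"
    proof -
      obtain i' where i': "i' \<in> {1..k}" "(p i 2, q) \<in> {(h, p i' 1), (p i' 1, p i' 2), (p i' 2, p i' 3),
          (p i' 1, h), (p i' 2, p i' 1), (p i' 3, p i' 2)}" using arc[OF e iS(2)] by blast
      then show ?thesis using p[OF i i'(1)] h[OF i] by auto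
    qed
    show "q = h \<or> q = p i 2" if e: "E (p i 1) q"
    proof -
      obtain i' where i': "i' \<in> {1..k}" "(p i 1, q) \<in> {(h, p i' 1), (p i' 1, p i' 2), (p i' 2, p i' 3),
          (p i' 1, h), (p i' 2, p i' 1), (p i' 3, p i' 2)}" using arc[OF e iS(1)] by blast
      then show ?thesis using p[OF i i'(1)] h[OF i] by auto
    qed
  next
    fix q assume q: "q \<in> pverts S" "E h q"
    have "h \<in> pverts S" using V by blast
    then obtain i' where i': "i' \<in> {1..k}" "(h, q) \<in> {(h, p i' 1), (p i' 1, p i' 2), (p i' 2, p i' 3),
        (p i' 1, h), (p i' 2, p i' 1), (p i' 3, p i' 2)}"
      using agree[of h q] q arcs[of h q] by blast
    then show "q \<in> (\<lambda>i. p i 1) ` {1..k}" using h[OF i'(1)] by auto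
  next
    show "2 \<le> card {1..k}" using k by simp
  qed (fact fin finite_atLeastAtMost sym V disj cut)+
  then show thesis by (rule that)
qed

text \<open>Puts the second operation under the spider analysis, with \<open>v1\<close> as head of
  two legs.\<close>

lemma path7_spider:
  assumes "distinct [v4, v3, v2, v1, v5, v6, v7]"
  shows "is_spider 2 v1 (path_graph [v4, v3, v2, v1, v5, v6, v7])"
proof -
  define p :: "nat \<Rightarrow> nat \<Rightarrow> 'a" where "p i j = (if i = 1 then (if j = 1 then v2 else if j = 2 then v3 else v4)
    else (if j = 1 then v5 else if j = 2 then v6 else v7))" for i j
  have I: "{1..2::nat} = {1, 2}" by auto
  have "inj_on (\<lambda>(i, j). p i j) ({1..2} \<times> {1..3})"
    unfolding I interval_1_3 inj_on_def using assms by (auto simp: p_def)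
  moreover have "\<forall>i\<in>{1..2}. \<forall>j\<in>{1..3}. p i j \<noteq> v1"
    unfolding I interval_1_3 using assms by (auto simp: p_def)
  moreover have "path_graph [v4, v3, v2, v1, v5, v6, v7] = spider_graph 2 v1 p"
  proof (rule pair_pre_digraph.equality)
    show "pverts (path_graph [v4, v3, v2, v1, v5, v6, v7]) = pverts (spider_graph 2 v1 p)"
      unfolding path_graph_simps spider_verts I by (auto simp: p_def)
    show "parcs (path_graph [v4, v3, v2, v1, v5, v6, v7]) = parcs (spider_graph 2 v1 p)"
      unfolding path_graph_simps spider_graph_simps I by (auto simp: p_def)
  qed simp
  ultimately show ?thesis unfolding is_spider_def by blast
qed

lemma attach_simps:
  "pverts (attach G x H y) = pverts G \<union> pverts H"
  "parcs (attach G x H y) = parcs G \<union> parcs H \<union> {(x, y), (y, x)}"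
  by (simp_all add: attach_def)

lemma attach_adj:
  assumes G: "is_tree G" and H: "parcs H \<subseteq> pverts H \<times> pverts H" and disj: "pverts G \<inter> pverts H = {}"
    and xy: "x \<in> pverts G" "y \<in> pverts H"
  shows "\<And>u v. u \<in> pverts G \<Longrightarrow> v \<in> pverts G \<Longrightarrow> adj (attach G x H y) u v \<longleftrightarrow> adj G u v"
    and "\<And>u v. u \<in> pverts H \<Longrightarrow> v \<in> pverts H \<Longrightarrow> adj (attach G x H y) u v \<longleftrightarrow> adj H u v"
    and "\<forall>u\<in>pverts G. \<forall>p\<in>pverts H. adj (attach G x H y) u p \<longrightarrow> u = x \<and> p = y"
    and "adj (attach G x H y) x y"
  using is_treeD(2)[OF G] H disj xy unfolding attach_simps by auto

section \<open>The operations preserve stability\<close>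

lemma op1_stable:
  assumes T: "is_tree T" and T': "is_tree T'" and op: "op1 T T'" and st: "stable2 (adj T) (pverts T)"
  shows "stable2 (adj T') (pverts T')"
proof -
  obtain x y l m where x: "x \<in> W0 (with_proj T)" and d: "distinct [l, y, m]"
    and disj: "pverts T \<inter> {l, y, m} = {}" and T'e: "T' = attach T x (path_graph [l, y, m]) y"
    using op unfolding op1_def by blast
  let ?H = "path_graph [l, y, m]"
  have W: "x \<in> pverts T" "\<And>S. minset (adj T) (pverts T) S \<Longrightarrow> x \<notin> S"
    using x unfolding W0_iff[OF T] by auto
  have H: "pverts ?H = {l, y, m}" "parcs ?H = {(l, y), (y, m), (y, l), (m, y)}"
    unfolding path_graph_simps by auto
  have V': "pverts T' = pverts T \<union> {l, y, m}" unfolding T'e attach_simps H by simp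
  have "parcs ?H \<subseteq> pverts ?H \<times> pverts ?H" "pverts T \<inter> pverts ?H = {}" "y \<in> pverts ?H"
    using disj unfolding H by auto
  note a = attach_adj[OF T this(1,2) W(1) this(3), folded T'e, unfolded H(1)]
  interpret pendant_P3 "adj T'" "pverts T" x y l m
  proof
    fix p assume "p \<in> {l, y, m}" "adj T' l p \<or> adj T' m p"
    then have "adj ?H l p \<or> adj ?H m p" using a(2) by blast
    then show "p = y" using d unfolding H by auto
  next
    show "adj T' y l" "adj T' y m" using a(2) unfolding H by auto
  qed (use d disj a(3) is_treeD(1)[OF T] is_treeD(3)[OF T'] in auto)
  have "stable2 (adj T') (pverts T)" using st stable2_cong[of "pverts T" "adj T'" "adj T"] a(1) by blast
  moreover have "\<forall>S. minset (adj T') (pverts T) S \<longrightarrow> x \<notin> S"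
    using W(2) minset_cong[of "pverts T" "adj T'" "adj T"] a(1) by blast
  ultimately show ?thesis using not_minset_iff a(4) unfolding V' by blast
qed

text \<open>Common to the second and third operation: \<open>side\<close> is the attaching condition
  of the one or the leg count of the other.\<close>

lemma spider_step_stable:
  assumes T: "is_tree T" and T': "is_tree T'" and x: "x \<in> pverts T" and S: "is_spider k y S"
    and disj: "pverts T \<inter> pverts S = {}" and T'e: "T' = attach T x S y"
    and side: "3 \<le> k \<or> x \<notin> W0 (with_proj T)" and st: "stable2 (adj T) (pverts T)"
  shows "stable2 (adj T') (pverts T')"
proof -
  obtain p where p: "S = spider_graph k y p" using S unfolding is_spider_def by blast
  have H: "parcs S \<subseteq> pverts S \<times> pverts S" "y \<in> pverts S"
    unfolding p spider_verts spider_graph_simps(2) by auto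
  note a = attach_adj[OF T H(1) disj x H(2), folded T'e]
  obtain q b c where "pendant_spider (adj T') (pverts T) x y {1..k} q b c (pverts S)"
    using spider_pendant[OF S is_treeD(3)[OF T'] is_treeD(1)[OF T] disj a(2,3)] by blast
  then interpret pendant_spider "adj T'" "pverts T" x y "{1..k}" q b c "pverts S" .
  have "stable2 (adj T') (pverts T)" using st stable2_cong[of "pverts T" "adj T'" "adj T"] a(1) by blast
  moreover have "3 \<le> card {1..k} \<or> (\<exists>S. minset (adj T') (pverts T) S \<and> x \<in> S)"
    using side x minset_cong[of "pverts T" "adj T'" "adj T"] a(1) unfolding W0_iff[OF T] by auto
  ultimately have "stable2 (adj T') (pverts T \<union> pverts S)" using stable_iff a(4) by blast
  then show ?thesis unfolding T'e attach_simps .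
qed

lemma op2_stable:
  assumes "is_tree T" "is_tree T'" "op2 T T'" "stable2 (adj T) (pverts T)"
  shows "stable2 (adj T') (pverts T')"
proof -
  obtain x v1 v2 v3 v4 v5 v6 v7 where x: "x \<in> pverts T - W0 (with_proj T)"
    and d: "distinct [v4, v3, v2, v1, v5, v6, v7]" "pverts T \<inter> {v4, v3, v2, v1, v5, v6, v7} = {}"
    and e: "T' = attach T x (path_graph [v4, v3, v2, v1, v5, v6, v7]) v1"
    using assms(3) unfolding op2_def by blast
  show ?thesis
    by (rule spider_step_stable[OF assms(1,2) _ path7_spider[OF d(1)] _ e _ assms(4)])
      (use x d(2) in \<open>auto simp: path_graph_simps(1)\<close>)
qed

lemma op3_stable:
  assumes "is_tree T" "is_tree T'" "op3 T T'" "stable2 (adj T) (pverts T)"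
  shows "stable2 (adj T') (pverts T')"
proof -
  obtain x k v1 S where "x \<in> pverts T" "3 \<le> k" "is_spider k v1 S" "pverts T \<inter> pverts S = {}"
    "T' = attach T x S v1"
    using assms(3) unfolding op3_def by blast
  then show ?thesis using spider_step_stable[OF assms(1,2) _ _ _ _ _ assms(4)] by blast
qed

lemma stable2_empty: "stable2 E {}"
  unfolding stable2_def by simp

lemma P3_stable:
  assumes T: "is_tree T" and P: "is_P3 T"
  shows "stable2 (adj T) (pverts T)"
proof -
  obtain xs where xs: "length xs = 3" "distinct xs" "T = path_graph xs"
    using P unfolding is_P3_def by blast
  then obtain l y m where e: "xs = [l, y, m]"
    by (auto simp: numeral_3_eq_3 length_Suc_conv)
  have H: "pverts T = {l, y, m}" "parcs T = {(l, y), (y, m), (y, l), (m, y)}"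
    unfolding xs(3) e path_graph_simps by auto
  \<comment> \<open>With \<open>R\<close> empty there is nothing to attach to, and \<open>y\<close>
    fills the place of \<open>x\<close>; the side condition holds because the only subset of the
    empty graph is empty.\<close>
  interpret pendant_P3 "adj T" "{}" y y l m
  proof
    show "symp (adj T)" by (rule is_treeD(3)[OF T])
  qed (use xs(2) in \<open>auto simp: H e\<close>)
  have "\<forall>S. minset (adj T) {} S \<longrightarrow> y \<notin> S" unfolding minset_def by blast
  then show ?thesis using not_minset_iff stable2_empty unfolding H(1) by simp
qed

lemma spider_stable:
  assumes T: "is_tree T" and S: "is_spider k h T" and k: "3 \<le> k"
  shows "stable2 (adj T) (pverts T)"
proof -
  obtain a b c where "pendant_spider (adj T) {} h h {1..k} a b c (pverts T)"
    using spider_pendant[OF S is_treeD(3)[OF T], of "{}" h] by auto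
  then interpret pendant_spider "adj T" "{}" h h "{1..k}" a b c "pverts T" .
  show ?thesis using stable_iff stable2_empty k by simp
qed

lemma family_stable:
  assumes "T \<in> tree_family"
  shows "stable2 (adj T) (pverts T)"
proof -
  obtain Ts where Ts: "Ts \<noteq> []" "\<forall>S\<in>set Ts. is_tree S"
    and base: "is_P3 (hd Ts) \<or> (\<exists>k h. 3 \<le> k \<and> is_spider k h (hd Ts))"
    and step: "\<forall>i. Suc i < length Ts \<longrightarrow>
        op1 (Ts ! i) (Ts ! Suc i) \<or> op2 (Ts ! i) (Ts ! Suc i) \<or> op3 (Ts ! i) (Ts ! Suc i)"
    and last: "last Ts = T"
    using assms unfolding tree_family_def mem_Collect_eq by (elim exE conjE) (rule that)
  have "stable2 (adj (Ts ! i)) (pverts (Ts ! i))" if "i < length Ts" for i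
    using that
  proof (induction i)
    case 0
    have t: "is_tree (hd Ts)" using Ts by simp
    from base have "stable2 (adj (hd Ts)) (pverts (hd Ts))"
    proof
      assume "is_P3 (hd Ts)"
      then show ?thesis by (rule P3_stable[OF t])
    next
      assume "\<exists>k h. 3 \<le> k \<and> is_spider k h (hd Ts)"
      then show ?thesis using spider_stable[OF t] by blast
    qed
    then show ?case using Ts(1) by (simp add: hd_conv_nth)
  next
    case (Suc i)
    then have t: "is_tree (Ts ! i)" "is_tree (Ts ! Suc i)" using Ts(2) by auto
    have "stable2 (adj (Ts ! i)) (pverts (Ts ! i))" using Suc by simp
    then show ?case using step Suc.prems op1_stable[OF t] op2_stable[OF t] op3_stable[OF t] by blast
  qed
  moreover have "T = Ts ! (length Ts - 1)" "length Ts - 1 < length Ts"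
    using last Ts(1) by (auto simp: last_conv_nth)
  ultimately show ?thesis by simp
qed

section \<open>Stable trees belong to the family\<close>

lemma family_base:
  "is_tree T \<Longrightarrow> is_P3 T \<or> (\<exists>k h. 3 \<le> k \<and> is_spider k h T) \<Longrightarrow> T \<in> tree_family"
  unfolding tree_family_def by (intro CollectI exI[of _ "[T]"]) auto

lemma family_step:
  assumes "T0 \<in> tree_family" "is_tree T" "op1 T0 T \<or> op2 T0 T \<or> op3 T0 T"
  shows "T \<in> tree_family"
proof -
  obtain Ts where Ts: "Ts \<noteq> []" "\<forall>S\<in>set Ts. is_tree S"
    "is_P3 (hd Ts) \<or> (\<exists>k h. 3 \<le> k \<and> is_spider k h (hd Ts))"
    and step: "\<And>i. Suc i < length Ts \<Longrightarrow>
        op1 (Ts ! i) (Ts ! Suc i) \<or> op2 (Ts ! i) (Ts ! Suc i) \<or> op3 (Ts ! i) (Ts ! Suc i)"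
    and last: "last Ts = T0"
    using assms(1) unfolding tree_family_def by blast
  let ?Us = "Ts @ [T]"
  have "op1 (?Us ! i) (?Us ! Suc i) \<or> op2 (?Us ! i) (?Us ! Suc i) \<or> op3 (?Us ! i) (?Us ! Suc i)"
    if "Suc i < length ?Us" for i
  proof (cases "Suc i < length Ts")
    case True
    then show ?thesis using step[OF True] by (simp add: nth_append)
  next
    case False
    then have "Suc i = length Ts" "i = length Ts - 1" using that by auto
    then have "?Us ! i = T0" "?Us ! Suc i = T"
      using last Ts(1) by (auto simp: nth_append last_conv_nth)
    then show ?thesis using assms(3) by simp
  qed
  then show ?thesis
    unfolding tree_family_def using Ts assms(2) by (intro CollectI exI[of _ ?Us]) auto
qed

lemma attach_induced:
  assumes T: "is_tree T" and V: "pverts T = R \<union> P" and xy: "x \<in> R" "y \<in> P" "adj T x y"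
    and cut: "\<forall>u\<in>R. \<forall>p\<in>P. adj T u p \<longrightarrow> u = x \<and> p = y"
    and S: "pverts S = P" "parcs S = parcs T \<inter> P \<times> P"
  shows "T = attach (induced T R) x S y"
proof (rule pair_pre_digraph.equality)
  note t = is_treeD[OF T]
  show "parcs T = parcs (attach (induced T R) x S y)"
  proof
    show "parcs (attach (induced T R) x S y) \<subseteq> parcs T"
      using xy(3) sympD[OF t(3) xy(3)] unfolding attach_simps S by auto
    show "parcs T \<subseteq> parcs (attach (induced T R) x S y)"
    proof
      fix e assume e: "e \<in> parcs T"
      obtain u v where uv: "e = (u, v)" by (cases e)
      then have uv': "adj T u v" "adj T v u" "u \<in> R \<union> P" "v \<in> R \<union> P"
        using e t(2) V sympD[OF t(3)] by auto
      then show "e \<in> parcs (attach (induced T R) x S y)"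
        using cut unfolding attach_simps S uv by auto
    qed
  qed
qed (simp_all add: attach_simps V S)

text \<open>Converts the abstract index set into numbered legs. The enumeration \<open>f\<close> is
  exposed because the second operation needs the path for two legs written out explicitly.\<close>

lemma pendant_spider_is_spider:
  assumes "pendant_spider E R x h I a b c P"
  obtains f :: "nat \<Rightarrow> 'i" and S where "bij_betw f {1..card I} I" "is_spider (card I) h S" "pverts S = P"
    "parcs S = {(u, v). u \<in> P \<and> v \<in> P \<and> E u v}"
    "card I = 2 \<Longrightarrow> S = path_graph [c (f 1), b (f 1), a (f 1), h, a (f 2), b (f 2), c (f 2)]"
proof -
  interpret pendant_spider E R x h I a b c P by fact
  define k where "k = card I"
  obtain f where f: "bij_betw f {1..k} I"
    unfolding k_def using ex_bij_betw_nat_finite_1[OF fin(2)] by blast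
  then have fI: "f ` {1..k} = I" and injf: "inj_on f {1..k}"
    unfolding bij_betw_def by auto
  define p where "p i j = (if j = 1 then a (f i) else if j = 2 then b (f i) else c (f i))" for i j :: nat
  have p: "p i 1 = a (f i)" "p i 2 = b (f i)" "p i 3 = c (f i)" "p i (Suc 0) = a (f i)" for i
    unfolding p_def by auto
  let ?S = "spider_graph k h p"
  have fi: "f i \<in> I" if "i \<in> {1..k}" for i using that fI by blast
  have sp: "is_spider k h ?S"
    unfolding is_spider_def
  proof (intro conjI exI[of _ p])
    show "2 \<le> k" using two unfolding k_def .
    show "\<forall>i\<in>{1..k}. \<forall>j\<in>{1..3}. p i j \<noteq> h"
      unfolding interval_1_3 using dist(2) fi by (auto simp: p)
    show "inj_on (\<lambda>(i, j). p i j) ({1..k} \<times> {1..3})"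
    proof (rule inj_onI, clarify)
      fix i j i' j' assume ij: "i \<in> {1..k}" "i' \<in> {1..k}" "j \<in> {1..3::nat}" "j' \<in> {1..3::nat}"
        and e: "p i j = p i' j'"
      have j: "j \<in> {1, 2, 3}" "j' \<in> {1, 2, 3}" using ij(3,4) by auto
      have ne: "a (f i) \<noteq> b (f i')" "a (f i) \<noteq> c (f i')" "b (f i) \<noteq> c (f i')"
        "a (f i') \<noteq> b (f i)" "a (f i') \<noteq> c (f i)" "b (f i') \<noteq> c (f i)"
        using dist(1) fi[OF ij(1)] fi[OF ij(2)] by blast+
      have "j = j'" using e j ne by (auto simp: p)
      moreover have "f i = f i'"
        using e j \<open>j = j'\<close> inj_onD[OF inj(1)] inj_onD[OF inj(2)] inj_onD[OF inj(3)] fi[OF ij(1)] fi[OF ij(2)]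
        by (auto simp: p)
      ultimately show "i = i' \<and> j = j'" using inj_onD[OF injf] ij by blast
    qed
  qed simp
  have im: "(\<lambda>i. p i 1) ` {1..k} = a ` I" "(\<lambda>i. p i 2) ` {1..k} = b ` I"
    "(\<lambda>i. p i 3) ` {1..k} = c ` I"
    unfolding p fI[symmetric] by (simp_all only: image_image)
  have V: "pverts ?S = P" unfolding spider_verts im P by simp
  have arcs: "parcs ?S = (\<Union>i\<in>I. {(h, a i), (a i, b i), (b i, c i), (a i, h), (b i, a i), (c i, b i)})"
    unfolding spider_graph_simps p fI[symmetric] by blast
  have "parcs ?S = {(u, v). u \<in> P \<and> v \<in> P \<and> E u v}"
  proof
    show "parcs ?S \<subseteq> {(u, v). u \<in> P \<and> v \<in> P \<and> E u v}"
      unfolding arcs using adj sympD[OF sym] P by auto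
    show "{(u, v). u \<in> P \<and> v \<in> P \<and> E u v} \<subseteq> parcs ?S"
    proof clarify
      fix u v assume uv: "u \<in> P" "v \<in> P" "E u v"
      from uv(1) consider "u = h" | i where "i \<in> I" "u = a i" | i where "i \<in> I" "u = b i"
        | i where "i \<in> I" "u = c i"
        using P by blast
      then show "adj ?S u v"
      proof cases
        case 1
        then show ?thesis using nbr(4)[OF uv(2)] uv(3) unfolding arcs by blast
      next
        case 2
        then show ?thesis using nbr(3)[OF 2(1) uv(2)] uv(3) unfolding arcs by blast
      next
        case 3
        then show ?thesis using nbr(2)[OF 3(1) uv(2)] uv(3) unfolding arcs by blast
      next
        case 4
        then show ?thesis using nbr(1)[OF 4(1) uv(2)] uv(3) unfolding arcs by blast
      qed
    qed
  qed
  moreover have "?S = path_graph [c (f 1), b (f 1), a (f 1), h, a (f 2), b (f 2), c (f 2)]" if k: "k = 2"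
  proof (rule pair_pre_digraph.equality)
    have I: "I = {f 1, f 2}" using fI unfolding k by (auto simp: atLeastAtMost_insertL[symmetric] numeral_2_eq_2)
    show "pverts ?S = pverts (path_graph [c (f 1), b (f 1), a (f 1), h, a (f 2), b (f 2), c (f 2)])"
      unfolding V P path_graph_simps I by auto
    show "parcs ?S = parcs (path_graph [c (f 1), b (f 1), a (f 1), h, a (f 2), b (f 2), c (f 2)])"
      unfolding arcs path_graph_simps I by auto
  qed simp
  ultimately show thesis using that[OF f[unfolded k_def] sp[unfolded k_def] V[unfolded k_def]] unfolding k_def by blast
qed

text \<open>Strong induction on the order. The equivalences for attached pieces are read backwards:
  stability of \<open>T\<close> yields at once that the remainder is stable and that the side
  condition of the matching operation holds.\<close>

lemma stable_in_family:
  assumes "is_tree T" "stable2 (adj T) (pverts T)"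
  shows "T \<in> tree_family"
  using assms
proof (induction "card (pverts T)" arbitrary: T rule: less_induct)
  case less
  note T = less.prems(1) and st = less.prems(2)
  note t = is_treeD[OF T]
  \<comment> \<open>Stated for an arbitrary pendant piece, so that both cases of
    \<open>decompose\<close> share it; \<open>eq\<close> expresses \<open>W0\<close> of the
    remainder by \<open>adj T\<close>, the relation in which the side conditions are
    obtained.\<close>
  have rec: "induced T R \<in> tree_family" "is_tree (induced T R)"
    and eq: "W0 (with_proj (induced T R)) = {v \<in> R. \<forall>S. minset (adj T) R S \<longrightarrow> v \<notin> S}"
    if V: "pverts T = R \<union> P" "R \<inter> P = {}" "R \<noteq> {}" "y \<in> P"
      and cut: "\<forall>u\<in>R. \<forall>p\<in>P. adj T u p \<longrightarrow> u = x \<and> p = y" and stR: "stable2 (adj T) R" for R P x y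
  proof -
    show tree: "is_tree (induced T R)" by (rule is_tree_remove_pendant[OF T V cut])
    have ag: "adj (induced T R) u v \<longleftrightarrow> adj T u v" if "u \<in> R" "v \<in> R" for u v
      using that by simp
    have "card R < card (pverts T)" using V t(1) by (intro psubset_card_mono) auto
    moreover have "stable2 (adj (induced T R)) R"
      using stable2_cong[of R "adj (induced T R)" "adj T"] ag stR by blast
    ultimately show "induced T R \<in> tree_family" using less.hyps[of "induced T R"] tree by simp
    show "W0 (with_proj (induced T R)) = {v \<in> R. \<forall>S. minset (adj T) R S \<longrightarrow> v \<notin> S}"
      unfolding W0_iff[OF tree] using minset_cong[of R "adj (induced T R)" "adj T"] ag by simp
  qed
  interpret stable_forest "adj T" "pverts T"
    using t st unfolding edge_connected_def by unfold_locales auto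
  have whole: "P = pverts T"
    if "P \<subseteq> pverts T" "P \<noteq> {}" "\<forall>u\<in>P. \<forall>v\<in>pverts T. adj T u v \<longrightarrow> v \<in> P" for P
    using t(5) that unfolding edge_connected_def by blast
  show ?case
  proof (cases rule: decompose)
    case (P3 x y l m)
    let ?P = "{l, y, m}" and ?R = "pverts T - {l, y, m}" and ?S = "path_graph [l, y, m]"
    interpret pendant_P3 "adj T" ?R x y l m by (rule P3(1))
    have V: "pverts T = ?R \<union> ?P" using P3(2) by blast
    have S: "pverts ?S = ?P" "parcs ?S = parcs T \<inter> ?P \<times> ?P"
    proof -
      show "pverts ?S = ?P" by (auto simp: path_graph_simps)
      have "\<not> adj T y y" using irreflpD[OF t(4)] .
      then show "parcs ?S = parcs T \<inter> ?P \<times> ?P"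
        using adj sympD[OF sym adj(1)] sympD[OF sym adj(2)] nbr unfolding path_graph_simps by auto
    qed
    have d: "distinct [l, y, m]" using dist by auto
    from P3(3) show ?thesis
    proof
      assume x: "x \<in> ?R \<and> adj T x y"
      then have c: "stable2 (adj T) ?R" "\<forall>S. minset (adj T) ?R S \<longrightarrow> x \<notin> S"
        using not_minset_iff st V by auto
      have ne: "?R \<noteq> {}" using x by blast
      note r = rec[OF V _ ne _ cut c(1)]
      have "x \<in> W0 (with_proj (induced T ?R))"
        using eq[OF V _ ne _ cut c(1)] c(2) x by blast
      moreover have "T = attach (induced T ?R) x ?S y"
        by (rule attach_induced[OF T V _ _ _ cut S]) (use x in auto)
      ultimately have "op1 (induced T ?R) T" unfolding op1_def using d by fastforce
      then show ?thesis using family_step r T by blast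
    next
      assume "nb (adj T) (pverts T) y \<subseteq> {l, m}"
      then have "adj T y v \<Longrightarrow> v \<in> pverts T \<Longrightarrow> v \<in> {l, m}" for v unfolding nb_def by blast
      moreover have "adj T l v \<or> adj T m v \<Longrightarrow> v \<in> pverts T \<Longrightarrow> v \<in> ?P" for v
        using cut sympD[OF sym] dist V by blast
      \<comment> \<open>The piece is closed under adjacency, so connectivity makes it the whole
        tree.\<close>
      ultimately have "?P = pverts T" using whole[OF P3(2)] by blast
      then have "T = ?S" using S t(2) by (intro pair_pre_digraph.equality) auto
      then have "is_P3 T" unfolding is_P3_def using d by (intro exI[of _ "[l, y, m]"]) simp
      then show ?thesis using family_base T by blast
    qed
  next
    case (spider x h I b c P)
    let ?R = "pverts T - P"
    interpret pendant_spider "adj T" ?R x h I "\<lambda>i. i" b c P by (rule spider(1))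
    have V: "pverts T = ?R \<union> P" using spider(2) by blast
    obtain f S where f: "bij_betw f {1..card I} I" and sp: "is_spider (card I) h S" and S: "pverts S = P"
        "parcs S = {(u, v). u \<in> P \<and> v \<in> P \<and> adj T u v}"
      and path: "card I = 2 \<Longrightarrow> S = path_graph [c (f 1), b (f 1), f 1, h, f 2, b (f 2), c (f 2)]"
      using pendant_spider_is_spider[OF spider(1)] by blast
    have S2: "parcs S = parcs T \<inter> P \<times> P" unfolding S(2) by auto
    have hP: "h \<in> P" using P by blast
    from spider(3) show ?thesis
    proof
      assume x: "x \<in> ?R \<and> adj T x h"
      then have c: "stable2 (adj T) ?R" "3 \<le> card I \<or> (\<exists>S. minset (adj T) ?R S \<and> x \<in> S)"
        using stable_iff st V by auto
      have ne: "?R \<noteq> {}" using x by blast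
      note r = rec[OF V disj ne hP cut c(1)]
      have e: "T = attach (induced T ?R) x S h"
        by (rule attach_induced[OF T V _ hP _ cut S(1) S2]) (use x in auto)
      have "op2 (induced T ?R) T \<or> op3 (induced T ?R) T"
      proof (cases "3 \<le> card I")
        case True
        have "x \<in> pverts (induced T ?R)" "pverts (induced T ?R) \<inter> pverts S = {}" using x S(1) by auto
        then have "op3 (induced T ?R) T" unfolding op3_def using True sp e by blast
        then show ?thesis ..
      next
        case False
        then have k: "card I = 2" using two by simp
        have x': "x \<in> pverts (induced T ?R) - W0 (with_proj (induced T ?R))"
          using eq[OF V disj ne hP cut c(1)] c(2) False x by auto
        have "f ` {1..2} = I" "inj_on f {1..2}" using f unfolding k bij_betw_def by auto
        then have fI: "f 1 \<in> I" "f 2 \<in> I" "f 1 \<noteq> f 2"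
          using inj_onD[of f "{1..2}" 1 2] by auto
        have "b (f 1) \<noteq> b (f 2)" "c (f 1) \<noteq> c (f 2)" using inj(2,3) fI by (auto dest: inj_onD)
        then have d: "distinct [c (f 1), b (f 1), f 1, h, f 2, b (f 2), c (f 2)]"
          using dist(1)[OF fI(1,1)] dist(1)[OF fI(1,2)] dist(1)[OF fI(2,1)] dist(1)[OF fI(2,2)]
            dist(2)[OF fI(1)] dist(2)[OF fI(2)] fI(3) by auto
        have "pverts (induced T ?R) \<inter> {c (f 1), b (f 1), f 1, h, f 2, b (f 2), c (f 2)} = {}"
          using S(1) path[OF k] by (auto simp: path_graph_simps)
        then have "op2 (induced T ?R) T"
          unfolding op2_def using x' d e[unfolded path[OF k]] by blast
        then show ?thesis ..
      qed
      then show ?thesis using family_step r T by blast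
    next
      assume h: "nb (adj T) (pverts T) h \<subseteq> P \<and> 3 \<le> card I"
      have "v \<in> P" if "u \<in> P" "v \<in> pverts T" "adj T u v" for u v
      proof (rule ccontr)
        assume "v \<notin> P"
        then have "u = h" using cut sympD[OF sym that(3)] that by blast
        then show False using h that \<open>v \<notin> P\<close> unfolding nb_def by blast
      qed
      then have "P = pverts T" using whole[OF spider(2)] hP by blast
      then have "T = S" using S(1) S2 t(2) by (intro pair_pre_digraph.equality) auto
      then show ?thesis using family_base T sp h by blast
    qed
  qed
qed

theorem theorem16:
  fixes T :: "'a pair_pre_digraph"
  assumes "is_tree T" and "3 \<le> card (pverts T)"
  shows "gamma_ri2_stable (with_proj T) \<longleftrightarrow> T \<in> tree_family"
proof
  assume "gamma_ri2_stable (with_proj T)"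
  then show "T \<in> tree_family"
    using gamma_ri2_stable_iff[OF assms(1)] stable_in_family[OF assms(1)] by simp
next
  assume "T \<in> tree_family"
  then show "gamma_ri2_stable (with_proj T)"
    using gamma_ri2_stable_iff[OF assms(1)] family_stable by simp
qed

end
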